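(* Given a contact projective structure on a co-oriented contact manifold $(M,H)$, let $\nabla$ be the affine connection associated to the contact one-form $\theta$, i.e. the unique affine connection, with torsion $\tau$, having the contact geodesics among its unparameterized geodesics and satisfying $\nabla\theta=0$, $\nabla d\theta=0$, $i(T)\tau=0$, and trace of $\tau$ equal to zero, where $T$ is the Reeb field of $\theta$. The torsion $\tau$ determines a section $\tau_{ij}{}^k$ of $\Lambda^2(H^* )\otimes H$ (the restriction of $\tau$ to $H\times H$ projected to $H$ along $T$) that is independent of the choice of scale $\theta$.
   Context: All objects are smooth. $(M,H)$ is a contact manifold of dimension $2n-1$, $n\ge2$ ($H$ a maximally non-integrable corank one distribution), co-oriented. A contact one-form (choice of scale) is a non-vanishing one-form $\theta$ annihilating $H$; its Reeb field $T$ satisfies $\theta(T)=1$, $i(T)d\theta=0$; a positive change of scale is $\tilde\theta=f^2\theta$, $f\ne0$. A path is a smoothly immersed one-dimensional submanifold; a contact path is one everywhere tangent to $H$. A contact projective structure is a $(4n-5)$-parameter family of contact paths (contact geodesics) such that for each $x\in M$ and one-dimensional $L\subset H_x$ there is a unique path of the family through $x$ tangent to $L$, and the paths are among the unparameterized geodesics of some affine connection (torsion allowed). The trace of $\tau$ is the one-form $Y\mapsto\mathrm{tr}(X\mapsto\tau(Y,X))$. The section $\tau_{ij}{}^k$ is called the contact torsion of the contact projective structure. *)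

theory Defs
  imports "HOL-Analysis.Analysis"
begin

section \<open>Smooth maps between Euclidean spaces\<close>

text \<open>\<open>Ck_on k S f\<close> is meant for open \<open>S\<close>: all iterated directional derivatives of \<open>f\<close> of order
  at most \<open>k\<close> exist (as total derivatives) and are continuous on \<open>S\<close>.\<close>

primrec Ck_on :: "nat \<Rightarrow> 'a::euclidean_space set \<Rightarrow> ('a \<Rightarrow> 'b::euclidean_space) \<Rightarrow> bool" where
  "Ck_on 0 S f \<longleftrightarrow> continuous_on S f"
| "Ck_on (Suc k) S f \<longleftrightarrow>
     (\<forall>x\<in>S. f differentiable (at x)) \<and> (\<forall>v. Ck_on k S (\<lambda>x. frechet_derivative f (at x) v))"

definition smooth_on :: "'a::euclidean_space set \<Rightarrow> ('a \<Rightarrow> 'b::euclidean_space) \<Rightarrow> bool" where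
  "smooth_on S f \<longleftrightarrow> (\<forall>k. Ck_on k S f)"


section \<open>Smooth manifolds\<close>

text \<open>A chart is a pair \<open>(U, \<phi>)\<close>; only the restriction of \<open>\<phi>\<close> to \<open>U\<close> matters. The manifold is the
  whole type \<open>'m\<close>, modelled on \<open>'e\<close>. Besides an atlas, the structure records a preferred chart
  around each point. Its only purpose is to identify each tangent space with \<open>'e\<close>: a tangent
  vector at \<open>p\<close> is represented by its components in the chart \<open>chart_at M p\<close>. The preferred chart
  need not depend continuously on \<open>p\<close>, so smoothness of a field is always tested on its components
  in a fixed chart of the atlas.\<close>

type_synonym ('m, 'e) chart = "'m set \<times> ('m \<Rightarrow> 'e)"

record ('m, 'e) manifold =
  atlas :: "('m, 'e) chart set"
  chart_at :: "'m \<Rightarrow> ('m, 'e) chart"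

definition chart_inv :: "('m, 'e) chart \<Rightarrow> 'e \<Rightarrow> 'm" where
  "chart_inv c = inv_into (fst c) (snd c)"

definition smooth_manifold ::
    "('m::{t2_space, second_countable_topology}, 'e::euclidean_space) manifold \<Rightarrow> bool" where
  "smooth_manifold M \<longleftrightarrow>
     (\<forall>c\<in>atlas M. open (fst c) \<and> open (snd c ` fst c) \<and>
        homeomorphism (fst c) (snd c ` fst c) (snd c) (chart_inv c)) \<and>
     (\<forall>c\<in>atlas M. \<forall>d\<in>atlas M. smooth_on (snd c ` (fst c \<inter> fst d)) (snd d \<circ> chart_inv c)) \<and>
     (\<forall>p. chart_at M p \<in> atlas M \<and> p \<in> fst (chart_at M p))"

definition smooth_fn ::
    "('m, 'e::euclidean_space) manifold \<Rightarrow> 'm set \<Rightarrow> ('m \<Rightarrow> 'b::euclidean_space) \<Rightarrow> bool" where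
  "smooth_fn M W f \<longleftrightarrow> (\<forall>c\<in>atlas M. smooth_on (snd c ` (W \<inter> fst c)) (f \<circ> chart_inv c))"


section \<open>Tangent vectors and vector fields\<close>

definition coord_change ::
    "('m, 'e::euclidean_space) chart \<Rightarrow> ('m, 'e) chart \<Rightarrow> 'm \<Rightarrow> 'e \<Rightarrow> 'e" where
  "coord_change c d p = frechet_derivative (snd d \<circ> chart_inv c) (at (snd c p))"

definition components ::
    "('m, 'e::euclidean_space) manifold \<Rightarrow> ('m, 'e) chart \<Rightarrow> 'm \<Rightarrow> 'e \<Rightarrow> 'e" where
  "components M c p v = coord_change (chart_at M p) c p v"

text \<open>The vector field (defined near \<open>p\<close>) with value \<open>v\<close> at \<open>p\<close> whose components in the chart
  \<open>chart_at M p\<close> are constant.\<close>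

definition extend ::
    "('m, 'e::euclidean_space) manifold \<Rightarrow> 'm \<Rightarrow> 'e \<Rightarrow> 'm \<Rightarrow> 'e" where
  "extend M p v q = coord_change (chart_at M p) (chart_at M q) q v"

definition smooth_vf ::
    "('m, 'e::euclidean_space) manifold \<Rightarrow> 'm set \<Rightarrow> ('m \<Rightarrow> 'e) \<Rightarrow> bool" where
  "smooth_vf M W X \<longleftrightarrow>
     (\<forall>c\<in>atlas M. smooth_on (snd c ` (W \<inter> fst c)) ((\<lambda>q. components M c q (X q)) \<circ> chart_inv c))"

definition dir_deriv ::
    "('m, 'e::euclidean_space) manifold \<Rightarrow> 'm \<Rightarrow> 'e \<Rightarrow> ('m \<Rightarrow> 'b::euclidean_space) \<Rightarrow> 'b" where
  "dir_deriv M p v f =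
     frechet_derivative (f \<circ> chart_inv (chart_at M p)) (at (snd (chart_at M p) p)) v"

definition lie_bracket ::
    "('m, 'e::euclidean_space) manifold \<Rightarrow> ('m \<Rightarrow> 'e) \<Rightarrow> ('m \<Rightarrow> 'e) \<Rightarrow> 'm \<Rightarrow> 'e" where
  "lie_bracket M X Y p =
     dir_deriv M p (X p) (\<lambda>q. components M (chart_at M p) q (Y q)) -
     dir_deriv M p (Y p) (\<lambda>q. components M (chart_at M p) q (X q))"


section \<open>One-forms and contact structures\<close>

definition one_form_on ::
    "('m::topological_space, 'e::euclidean_space) manifold \<Rightarrow> 'm set \<Rightarrow> ('m \<Rightarrow> 'e \<Rightarrow> real) \<Rightarrow> bool"
  where
  "one_form_on M W \<alpha> \<longleftrightarrow>
     (\<forall>p\<in>W. linear (\<alpha> p)) \<and>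
     (\<forall>V X. open V \<and> V \<subseteq> W \<and> smooth_vf M V X \<longrightarrow> smooth_fn M V (\<lambda>p. \<alpha> p (X p)))"

text \<open>The value of the right-hand side of the Cartan formula
  \<open>d\<alpha>(X,Y) = X(\<alpha>(Y)) - Y(\<alpha>(X)) - \<alpha>([X,Y])\<close> at \<open>p\<close> depends only on the values of \<open>X\<close> and \<open>Y\<close>
  at \<open>p\<close>, so any local extension of tangent vectors may be used.\<close>

definition ext_deriv ::
    "('m, 'e::euclidean_space) manifold \<Rightarrow> ('m \<Rightarrow> 'e \<Rightarrow> real) \<Rightarrow> 'm \<Rightarrow> 'e \<Rightarrow> 'e \<Rightarrow> real" where
  "ext_deriv M \<alpha> p u v =
     (let X = extend M p u; Y = extend M p v in
        dir_deriv M p u (\<lambda>q. \<alpha> q (Y q)) - dir_deriv M p v (\<lambda>q. \<alpha> q (X q))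
        - \<alpha> p (lie_bracket M X Y p))"

definition annihilating_form ::
    "('m::topological_space, 'e::euclidean_space) manifold \<Rightarrow> ('m \<Rightarrow> 'e set) \<Rightarrow> 'm set \<Rightarrow>
       ('m \<Rightarrow> 'e \<Rightarrow> real) \<Rightarrow> bool" where
  "annihilating_form M H W \<alpha> \<longleftrightarrow>
     one_form_on M W \<alpha> \<and> (\<forall>p\<in>W. (\<exists>v. \<alpha> p v \<noteq> 0) \<and> (\<forall>v\<in>H p. \<alpha> p v = 0))"

text \<open>A smooth corank one distribution that is maximally non-integrable, i.e. the differential of
  every local non-vanishing annihilating one-form is non-degenerate on the distribution.\<close>

definition contact_structure ::
    "('m::topological_space, 'e::euclidean_space) manifold \<Rightarrow> ('m \<Rightarrow> 'e set) \<Rightarrow> bool" where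
  "contact_structure M H \<longleftrightarrow>
     (\<forall>p. subspace (H p) \<and> dim (H p) + 1 = DIM('e)) \<and>
     (\<forall>p. \<exists>W \<alpha>. open W \<and> p \<in> W \<and> annihilating_form M H W \<alpha>) \<and>
     (\<forall>W \<alpha>. open W \<and> annihilating_form M H W \<alpha> \<longrightarrow>
        (\<forall>p\<in>W. \<forall>u\<in>H p. u \<noteq> 0 \<longrightarrow> (\<exists>v\<in>H p. ext_deriv M \<alpha> p u v \<noteq> 0)))"

definition contact_form ::
    "('m::topological_space, 'e::euclidean_space) manifold \<Rightarrow> ('m \<Rightarrow> 'e set) \<Rightarrow>
       ('m \<Rightarrow> 'e \<Rightarrow> real) \<Rightarrow> bool" where
  "contact_form M H \<theta> \<longleftrightarrow> annihilating_form M H UNIV \<theta>"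

definition positive_rescaling ::
    "('m::topological_space, 'e::euclidean_space) manifold \<Rightarrow> ('m \<Rightarrow> 'e \<Rightarrow> real) \<Rightarrow>
       ('m \<Rightarrow> 'e \<Rightarrow> real) \<Rightarrow> bool" where
  "positive_rescaling M \<theta> \<theta>' \<longleftrightarrow>
     (\<exists>f. smooth_fn M UNIV f \<and> (\<forall>p. f p \<noteq> 0) \<and> (\<forall>p v. \<theta>' p v = (f p)\<^sup>2 * \<theta> p v))"

text \<open>A co-orientation is given by its class \<open>Sc\<close> of scales: all the contact one-forms that are
  positive rescalings of a given one.\<close>

definition co_orientation ::
    "('m::topological_space, 'e::euclidean_space) manifold \<Rightarrow> ('m \<Rightarrow> 'e set) \<Rightarrow>
       ('m \<Rightarrow> 'e \<Rightarrow> real) set \<Rightarrow> bool" where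
  "co_orientation M H Sc \<longleftrightarrow>
     (\<exists>\<theta>. contact_form M H \<theta> \<and> Sc = {\<theta>'. positive_rescaling M \<theta> \<theta>'})"

definition reeb_field ::
    "('m, 'e::euclidean_space) manifold \<Rightarrow> ('m \<Rightarrow> 'e \<Rightarrow> real) \<Rightarrow> ('m \<Rightarrow> 'e) \<Rightarrow> bool" where
  "reeb_field M \<theta> T \<longleftrightarrow>
     smooth_vf M UNIV T \<and> (\<forall>p. \<theta> p (T p) = 1) \<and> (\<forall>p v. ext_deriv M \<theta> p (T p) v = 0)"


section \<open>Affine connections\<close>

text \<open>\<open>D p v Y\<close> is the covariant derivative at \<open>p\<close>, in the direction of the tangent vector \<open>v\<close>, of a
  vector field \<open>Y\<close> that is defined and smooth near \<open>p\<close> (its values elsewhere are irrelevant). An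
  affine connection on globally defined vector fields extends uniquely to such local fields.\<close>

type_synonym ('m, 'e) connection = "'m \<Rightarrow> 'e \<Rightarrow> ('m \<Rightarrow> 'e) \<Rightarrow> 'e"

definition affine_connection ::
    "('m::topological_space, 'e::euclidean_space) manifold \<Rightarrow> ('m, 'e) connection \<Rightarrow> bool" where
  "affine_connection M D \<longleftrightarrow>
     (\<forall>W Y. open W \<and> smooth_vf M W Y \<longrightarrow>
        (\<forall>p\<in>W. linear (\<lambda>v. D p v Y)) \<and>
        (\<forall>Z. smooth_vf M W Z \<longrightarrow>
           (\<forall>p\<in>W. \<forall>v. D p v (\<lambda>q. Y q + Z q) = D p v Y + D p v Z)) \<and>
        (\<forall>f :: 'm \<Rightarrow> real. smooth_fn M W f \<longrightarrow>
           (\<forall>p\<in>W. \<forall>v. D p v (\<lambda>q. f q *\<^sub>R Y q) = dir_deriv M p v f *\<^sub>R Y p + f p *\<^sub>R D p v Y)) \<and>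
        (\<forall>Z. smooth_vf M W Z \<and> (\<forall>q\<in>W. Y q = Z q) \<longrightarrow> (\<forall>p\<in>W. \<forall>v. D p v Y = D p v Z)) \<and>
        (\<forall>X. smooth_vf M W X \<longrightarrow> smooth_vf M W (\<lambda>p. D p (X p) Y)))"

text \<open>\<open>\<tau>(X,Y) = D\<^sub>X Y - D\<^sub>Y X - [X,Y]\<close>; as for the exterior derivative, the value at \<open>p\<close> does not
  depend on the choice of local extensions.\<close>

definition torsion ::
    "('m, 'e::euclidean_space) manifold \<Rightarrow> ('m, 'e) connection \<Rightarrow> 'm \<Rightarrow> 'e \<Rightarrow> 'e \<Rightarrow> 'e" where
  "torsion M D p u v =
     (let X = extend M p u; Y = extend M p v in D p u Y - D p v X - lie_bracket M X Y p)"

definition lin_trace :: "('e::euclidean_space \<Rightarrow> 'e) \<Rightarrow> real" where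
  "lin_trace L = (\<Sum>b\<in>Basis. L b \<bullet> b)"

definition parallel_one_form ::
    "('m::topological_space, 'e::euclidean_space) manifold \<Rightarrow> ('m, 'e) connection \<Rightarrow>
       ('m \<Rightarrow> 'e \<Rightarrow> real) \<Rightarrow> bool" where
  "parallel_one_form M D \<alpha> \<longleftrightarrow>
     (\<forall>W Y. open W \<and> smooth_vf M W Y \<longrightarrow>
        (\<forall>p\<in>W. \<forall>v. dir_deriv M p v (\<lambda>q. \<alpha> q (Y q)) - \<alpha> p (D p v Y) = 0))"

definition parallel_two_form ::
    "('m::topological_space, 'e::euclidean_space) manifold \<Rightarrow> ('m, 'e) connection \<Rightarrow>
       ('m \<Rightarrow> 'e \<Rightarrow> 'e \<Rightarrow> real) \<Rightarrow> bool" where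
  "parallel_two_form M D \<omega> \<longleftrightarrow>
     (\<forall>W X Y. open W \<and> smooth_vf M W X \<and> smooth_vf M W Y \<longrightarrow>
        (\<forall>p\<in>W. \<forall>v. dir_deriv M p v (\<lambda>q. \<omega> q (X q) (Y q))
           - \<omega> p (D p v X) (Y p) - \<omega> p (X p) (D p v Y) = 0))"


section \<open>Paths and geodesics\<close>

text \<open>A parameterized curve is an immersion \<open>\<gamma>\<close> of a non-empty open interval \<open>I\<close>. A path is such a
  curve up to reparameterization; a closed path is represented by a periodic immersion of the
  real line.\<close>

type_synonym 'm curve = "real set \<times> (real \<Rightarrow> 'm)"

definition velocity ::
    "('m, 'e::euclidean_space) manifold \<Rightarrow> (real \<Rightarrow> 'm) \<Rightarrow> real \<Rightarrow> 'e" where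
  "velocity M \<gamma> t = vector_derivative (snd (chart_at M (\<gamma> t)) \<circ> \<gamma>) (at t)"

definition immersed_curve ::
    "('m::topological_space, 'e::euclidean_space) manifold \<Rightarrow> 'm curve \<Rightarrow> bool" where
  "immersed_curve M = (\<lambda>(I, \<gamma>).
     open I \<and> is_interval I \<and> I \<noteq> {} \<and> continuous_on I \<gamma> \<and>
     (\<forall>c\<in>atlas M. smooth_on {t\<in>I. \<gamma> t \<in> fst c} (snd c \<circ> \<gamma>)) \<and>
     (\<forall>t\<in>I. velocity M \<gamma> t \<noteq> 0))"

definition same_path :: "'m curve \<Rightarrow> 'm curve \<Rightarrow> bool" where
  "same_path = (\<lambda>(I, \<gamma>) (J, \<sigma>).
     \<exists>h :: real \<Rightarrow> real. bij_betw h I J \<and> smooth_on I h \<and> (\<forall>t\<in>I. deriv h t \<noteq> 0) \<and>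
       (\<forall>t\<in>I. \<gamma> t = \<sigma> (h t)))"

definition contact_path ::
    "('m::topological_space, 'e::euclidean_space) manifold \<Rightarrow> ('m \<Rightarrow> 'e set) \<Rightarrow> 'm curve \<Rightarrow> bool"
  where
  "contact_path M H c \<longleftrightarrow>
     immersed_curve M c \<and> (\<forall>t\<in>fst c. velocity M (snd c) t \<in> H (snd c t))"

definition tangent_to ::
    "('m, 'e::euclidean_space) manifold \<Rightarrow> 'm curve \<Rightarrow> 'm \<Rightarrow> 'e set \<Rightarrow> bool" where
  "tangent_to M c p L \<longleftrightarrow> (\<exists>t\<in>fst c. snd c t = p \<and> span {velocity M (snd c) t} = L)"

text \<open>Covariant derivative of a vector field \<open>V\<close> along \<open>\<gamma>\<close>: expand \<open>V\<close> near \<open>t\<close> in the coordinate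
  frame of the chart at \<open>\<gamma> t\<close> and apply the Leibniz rule; the first summand differentiates the
  coefficients, the second one the frame.\<close>

definition covariant_derivative_along ::
    "('m, 'e::euclidean_space) manifold \<Rightarrow> ('m, 'e) connection \<Rightarrow> (real \<Rightarrow> 'm) \<Rightarrow> (real \<Rightarrow> 'e) \<Rightarrow>
       real \<Rightarrow> 'e" where
  "covariant_derivative_along M D \<gamma> V t =
     vector_derivative (\<lambda>s. components M (chart_at M (\<gamma> t)) (\<gamma> s) (V s)) (at t)
     + D (\<gamma> t) (velocity M \<gamma> t) (extend M (\<gamma> t) (V t))"

definition geodesic ::
    "('m::topological_space, 'e::euclidean_space) manifold \<Rightarrow> ('m, 'e) connection \<Rightarrow> 'm curve \<Rightarrow> bool"
  where
  "geodesic M D c \<longleftrightarrow>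
     immersed_curve M c \<and>
     (\<forall>t\<in>fst c. covariant_derivative_along M D (snd c) (velocity M (snd c)) t = 0)"

definition unparameterized_geodesic ::
    "('m::topological_space, 'e::euclidean_space) manifold \<Rightarrow> ('m, 'e) connection \<Rightarrow> 'm curve \<Rightarrow> bool"
  where
  "unparameterized_geodesic M D c \<longleftrightarrow>
     immersed_curve M c \<and> (\<exists>c'. same_path c c' \<and> geodesic M D c')"


section \<open>Contact projective structures\<close>

text \<open>The family \<open>C\<close> consists of one or more parameterizations of each of the contact geodesics.\<close>

definition contact_projective_structure ::
    "('m::topological_space, 'e::euclidean_space) manifold \<Rightarrow> ('m \<Rightarrow> 'e set) \<Rightarrow> 'm curve set \<Rightarrow> bool"
  where
  "contact_projective_structure M H C \<longleftrightarrow>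
     (\<forall>c\<in>C. contact_path M H c) \<and>
     (\<forall>p L. subspace L \<and> dim L = 1 \<and> L \<subseteq> H p \<longrightarrow>
        (\<exists>c\<in>C. tangent_to M c p L) \<and>
        (\<forall>c\<in>C. \<forall>c'\<in>C. tangent_to M c p L \<and> tangent_to M c' p L \<longrightarrow> same_path c c')) \<and>
     (\<exists>D. affine_connection M D \<and> (\<forall>c\<in>C. unparameterized_geodesic M D c))"

definition associated_connection ::
    "('m::topological_space, 'e::euclidean_space) manifold \<Rightarrow> 'm curve set \<Rightarrow>
       ('m \<Rightarrow> 'e \<Rightarrow> real) \<Rightarrow> ('m \<Rightarrow> 'e) \<Rightarrow> ('m, 'e) connection \<Rightarrow> bool" where
  "associated_connection M C \<theta> T D \<longleftrightarrow>
     affine_connection M D \<and>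
     (\<forall>c\<in>C. unparameterized_geodesic M D c) \<and>
     parallel_one_form M D \<theta> \<and>
     parallel_two_form M D (ext_deriv M \<theta>) \<and>
     (\<forall>p v. torsion M D p (T p) v = 0) \<and>
     (\<forall>p y. lin_trace (\<lambda>x. torsion M D p y x) = 0)"

text \<open>The torsion followed by the projection onto \<open>H\<close> along the Reeb field \<open>T\<close> of \<open>\<theta>\<close>; only its
  restriction to \<open>H \<times> H\<close> is of interest.\<close>

definition contact_torsion ::
    "('m, 'e::euclidean_space) manifold \<Rightarrow> ('m \<Rightarrow> 'e \<Rightarrow> real) \<Rightarrow> ('m \<Rightarrow> 'e) \<Rightarrow> ('m, 'e) connection \<Rightarrow>
       'm \<Rightarrow> 'e \<Rightarrow> 'e \<Rightarrow> 'e" where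
  "contact_torsion M \<theta> T D p u v =
     torsion M D p u v - \<theta> p (torsion M D p u v) *\<^sub>R T p"

text \<open>Smooth sections of \<open>\<Lambda>\<^sup>2(H\<^sup>*) \<otimes> H\<close>.\<close>

definition section_Lambda2_dual_tensor ::
    "('m::topological_space, 'e::euclidean_space) manifold \<Rightarrow> ('m \<Rightarrow> 'e set) \<Rightarrow>
       ('m \<Rightarrow> 'e \<Rightarrow> 'e \<Rightarrow> 'e) \<Rightarrow> bool" where
  "section_Lambda2_dual_tensor M H S \<longleftrightarrow>
     (\<forall>p. \<forall>u\<in>H p. \<forall>v\<in>H p. S p u v \<in> H p \<and> S p u v = - S p v u) \<and>
     (\<forall>p. \<forall>u\<in>H p. \<forall>v\<in>H p. \<forall>w\<in>H p. \<forall>a b.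
        S p (a *\<^sub>R u + b *\<^sub>R v) w = a *\<^sub>R S p u w + b *\<^sub>R S p v w) \<and>
     (\<forall>W X Y. open W \<and> smooth_vf M W X \<and> smooth_vf M W Y \<and>
        (\<forall>q\<in>W. X q \<in> H q \<and> Y q \<in> H q) \<longrightarrow> smooth_vf M W (\<lambda>q. S q (X q) (Y q)))"

end

theory Submission
  imports Defs
begin

text \<open>Let \<open>\<theta>' = \<sigma>\<theta>\<close> be two scales, \<open>\<omega> = d\<theta>\<close>, and let \<open>D\<close>, \<open>D'\<close> be the associated connections, with
  torsions \<open>\<tau>\<close>, \<open>\<tau>'\<close>. Write \<open>\<Lambda> = D' - D\<close>, so that \<open>S(u,v) = \<Lambda>(u,v) - \<Lambda>(v,u)\<close> is the change
  \<open>\<tau>' - \<tau>\<close>, and \<open>Z = \<sigma>T' - T\<close> for the contact vector that measures the change of the Reeb field. The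
  Reeb equations say that \<open>\<omega>(Z,\<cdot>)\<close> is \<open>\<gamma> = d log \<sigma>\<close> on \<open>H\<close>. All the geometry enters through the
  following facts about \<open>\<Lambda>\<close> on \<open>H\<close>:

  \<^item> every contact direction is tangent to a path that is an unparameterized geodesic of both
    connections, so \<open>\<Lambda>(u,u)\<close> is a multiple of \<open>u\<close>, and polarization gives a one-form \<open>\<alpha>\<close> with
    \<open>\<Lambda>(u,v) + \<Lambda>(v,u) = \<alpha>(u) v + \<alpha>(v) u\<close> (\<open>common_geodesics_difference\<close>,
    \<open>eigen_quadratic_map_coefficient_linear\<close>);

  \<^item> \<open>D\<theta> = 0\<close> and \<open>D'\<theta>' = 0\<close> give \<open>\<theta>(\<Lambda>(u,v)) = 0\<close>, while \<open>D d\<theta> = 0\<close> and \<open>D' d\<theta>' = 0\<close> give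
    \<open>\<omega>(\<Lambda>(v,u),w) + \<omega>(u,\<Lambda>(v,w)) = \<gamma>(v) \<omega>(u,w)\<close> (\<open>rescaled_parallel_two_form\<close>).

  Permuting the arguments of the last identity, as for the Koszul formula, solves for \<open>S\<close>:
  \<open>S(u,v) = \<omega>(u,v) W + \<beta>(u) v - \<beta>(v) u\<close>, where \<open>\<beta> = \<gamma> - \<alpha>\<close> and \<open>\<omega>(W,\<cdot>) = 2\<alpha> - \<gamma>\<close>. Since both
  torsions are trace-free and killed by their Reeb fields, the trace of \<open>S(u,\<cdot>)\<close> is zero, and this
  reads \<open>\<beta>(u) dim M = 0\<close>. Hence \<open>\<alpha> = \<gamma>\<close>, \<open>W = Z\<close> and \<open>\<tau>' - \<tau> = \<omega> \<otimes> Z\<close> on \<open>H\<close>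
  (\<open>torsion_change_pointwise\<close>). The \<open>T\<close>-component of \<open>\<tau>\<close> is \<open>\<omega>\<close>, because \<open>\<theta>(\<tau>(u,v)) = d\<theta>(u,v)\<close>, and
  the \<open>T'\<close>-component of \<open>\<tau>'\<close> is \<open>\<sigma>\<omega>\<close>; as \<open>\<sigma>\<omega>T' = \<omega>T + \<omega>Z\<close>, these components account for exactly
  this difference, so the projections to \<open>H\<close> agree.

  Smoothness of \<open>\<tau>\<close> is needed both for the section and in order to differentiate
  \<open>d\<theta>(X,Y) = \<theta>(\<tau>(X,Y))\<close>. The torsion at \<open>q\<close> is defined by extending vectors constantly in the
  preferred chart at \<open>q\<close>, which may vary discontinuously. It is therefore evaluated on the coordinate
  fields of one fixed chart (\<open>torsion_fields\<close>), whose Lie brackets vanish by the symmetry of the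
  second derivatives of the transition maps (\<open>lie_bracket_chart_frame\<close>).\<close>

section \<open>Smooth maps between Euclidean spaces\<close>

lemma has_derivative_frechet:
  "f differentiable (at x) \<Longrightarrow> (f has_derivative frechet_derivative f (at x)) (at x)"
  by (simp add: frechet_derivative_works)

lemma frechet_derivativeI:
  "(f has_derivative f') (at x) \<Longrightarrow> frechet_derivative f (at x) = f'"
  by (metis frechet_derivative_at)

lemma Ck_on_subset: "Ck_on k S f \<Longrightarrow> T \<subseteq> S \<Longrightarrow> Ck_on k T f"
  by (induction k arbitrary: f) (auto intro: continuous_on_subset)

lemma Ck_on_cong:
  assumes "open S" "\<And>x. x \<in> S \<Longrightarrow> f x = g x" "Ck_on k S f"
  shows "Ck_on k S g"
  using assms(2,3)
proof (induction k arbitrary: f g)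
  case 0
  then show ?case by (metis Ck_on.simps(1) continuous_on_cong)
next
  case (Suc k)
  have der: "(g has_derivative frechet_derivative f (at x)) (at x)" if "x \<in> S" for x
    using Suc.prems that has_derivative_transform_within_open[OF has_derivative_frechet \<open>open S\<close>]
    by (metis Ck_on.simps(2))
  have "Ck_on k S (\<lambda>x. frechet_derivative g (at x) v)" for v
  proof (rule Suc.IH)
    show "frechet_derivative f (at x) v = frechet_derivative g (at x) v" if "x \<in> S" for x
      using frechet_derivativeI[OF der[OF that]] by simp
    show "Ck_on k S (\<lambda>x. frechet_derivative f (at x) v)"
      using Suc.prems by simp
  qed
  then show ?case using der by (auto simp: differentiable_def)
qed

lemma Ck_on_SucD: "Ck_on (Suc k) S f \<Longrightarrow> Ck_on k S f"
proof (induction k arbitrary: f)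
  case 0
  then show ?case
    by (auto intro!: continuous_at_imp_continuous_on differentiable_imp_continuous_within)
next
  case (Suc k)
  then show ?case by (metis Ck_on.simps(2))
qed

lemma Ck_on_SucI:
  assumes "open S" "\<And>x. x \<in> S \<Longrightarrow> (f has_derivative f' x) (at x)"
    and "\<And>v. Ck_on k S (\<lambda>x. f' x v)"
  shows "Ck_on (Suc k) S f"
  using assms(2,3) frechet_derivativeI[OF assms(2)]
  by (auto simp: differentiable_def intro!: Ck_on_cong[OF assms(1) _ assms(3)])

lemma Ck_on_const: "open S \<Longrightarrow> Ck_on k S (\<lambda>x. c)"
  by (induction k arbitrary: c) (auto simp: continuous_on_const)

lemma Ck_on_add:
  "\<lbrakk>open S; Ck_on k S f; Ck_on k S g\<rbrakk> \<Longrightarrow> Ck_on k S (\<lambda>x. f x + g x)"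
proof (induction k arbitrary: f g)
  case 0
  then show ?case by (auto intro: continuous_on_add)
next
  case (Suc k)
  show ?case
    by (rule Ck_on_SucI[where f' = "\<lambda>x v. frechet_derivative f (at x) v + frechet_derivative g (at x) v"])
       (use Suc in \<open>auto intro!: has_derivative_add has_derivative_frechet\<close>)
qed

lemma Ck_on_bounded_linear:
  assumes "bounded_linear L"
  shows "\<lbrakk>open S; Ck_on k S f\<rbrakk> \<Longrightarrow> Ck_on k S (\<lambda>x. L (f x))"
proof (induction k arbitrary: f)
  case 0
  then show ?case by (auto intro: bounded_linear.continuous_on[OF assms])
next
  case (Suc k)
  show ?case
    by (rule Ck_on_SucI[where f' = "\<lambda>x v. L (frechet_derivative f (at x) v)"])
       (use Suc in \<open>auto intro!: bounded_linear.has_derivative[OF assms] has_derivative_frechet\<close>)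
qed

lemma Ck_on_bounded_bilinear:
  assumes "bounded_bilinear B"
  shows "\<lbrakk>open S; Ck_on k S f; Ck_on k S g\<rbrakk> \<Longrightarrow> Ck_on k S (\<lambda>x. B (f x) (g x))"
proof (induction k arbitrary: f g)
  case 0
  then show ?case by (auto intro: bounded_bilinear.continuous_on[OF assms])
next
  case (Suc k)
  show ?case
  proof (rule Ck_on_SucI[where f' = "\<lambda>x v. B (f x) (frechet_derivative g (at x) v) +
                                             B (frechet_derivative f (at x) v) (g x)"])
    show "((\<lambda>x. B (f x) (g x)) has_derivative (\<lambda>v. B (f x) (frechet_derivative g (at x) v) +
            B (frechet_derivative f (at x) v) (g x))) (at x)" if "x \<in> S" for x
      using Suc.prems that
      by (auto intro!: bounded_bilinear.FDERIV[OF assms] has_derivative_frechet)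
    show "Ck_on k S (\<lambda>x. B (f x) (frechet_derivative g (at x) v) +
            B (frechet_derivative f (at x) v) (g x))" for v
      using Suc.prems Ck_on_SucD[OF Suc.prems(2)] Ck_on_SucD[OF Suc.prems(3)]
      by (intro Ck_on_add Suc.IH) auto
  qed (use Suc.prems in auto)
qed

lemma Ck_on_sum:
  "\<lbrakk>open S; \<And>i. i \<in> I \<Longrightarrow> Ck_on k S (f i)\<rbrakk> \<Longrightarrow> Ck_on k S (\<lambda>x. \<Sum>i\<in>I. f i x)"
  by (induction I rule: infinite_finite_induct) (auto intro: Ck_on_const Ck_on_add)

lemma Ck_on_inverse:
  fixes f :: "'a::euclidean_space \<Rightarrow> real"
  shows "\<lbrakk>open S; \<And>x. x \<in> S \<Longrightarrow> f x \<noteq> 0; Ck_on k S f\<rbrakk> \<Longrightarrow> Ck_on k S (\<lambda>x. inverse (f x))"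
proof (induction k)
  case 0
  then show ?case by (auto intro: continuous_on_inverse)
next
  case (Suc k)
  show ?case
  proof (rule Ck_on_SucI[where f' = "\<lambda>x v. - (inverse (f x) * frechet_derivative f (at x) v * inverse (f x))"])
    show "((\<lambda>x. inverse (f x)) has_derivative
        (\<lambda>v. - (inverse (f x) * frechet_derivative f (at x) v * inverse (f x)))) (at x)"
      if "x \<in> S" for x
      using Suc.prems that by (intro Deriv.has_derivative_inverse has_derivative_frechet) auto
    have inv: "Ck_on k S (\<lambda>x. inverse (f x))"
      using Suc.prems Ck_on_SucD by (intro Suc.IH) auto
    show "Ck_on k S (\<lambda>x. - (inverse (f x) * frechet_derivative f (at x) v * inverse (f x)))" for v
      using Suc.prems inv
      by (intro Ck_on_bounded_linear[OF bounded_linear_minus[OF bounded_linear_ident]]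
          Ck_on_bounded_bilinear[OF bounded_bilinear_mult]) auto
  qed (use Suc.prems in auto)
qed

text \<open>The chain rule \<open>D(g \<circ> f)(x) v = Dg(f x) (Df(x) v)\<close> leaves the predicate, because its direction
  depends on \<open>x\<close>. Expanding that direction in a basis writes it as a sum of products of functions
  covered by the induction hypothesis.\<close>

lemma Ck_on_compose:
  assumes "open S" "open R"
  shows "\<lbrakk>Ck_on k S f; Ck_on k R g; f ` S \<subseteq> R\<rbrakk> \<Longrightarrow> Ck_on k S (g \<circ> f)"
proof (induction k arbitrary: g)
  case 0
  then show ?case by (auto simp: o_def intro: continuous_on_compose2)
next
  case (Suc k)
  let ?Dg = "\<lambda>b x. frechet_derivative g (at x) b"
  let ?Df = "\<lambda>x v. frechet_derivative f (at x) v"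
  have expand: "?Dg (?Df x v) (f x) = (\<Sum>b\<in>Basis. (?Df x v \<bullet> b) *\<^sub>R (?Dg b \<circ> f) x)" if "x \<in> S" for x v
  proof -
    have "linear (frechet_derivative g (at (f x)))"
      using Suc.prems that by (intro linear_frechet_derivative) auto
    then show ?thesis
      by (subst (1) euclidean_representation[symmetric])
         (simp add: linear_sum linear_scale)
  qed
  show ?case
  proof (rule Ck_on_SucI[where f' = "\<lambda>x v. \<Sum>b\<in>Basis. (?Df x v \<bullet> b) *\<^sub>R (?Dg b \<circ> f) x"])
    fix x assume x: "x \<in> S"
    have "(g \<circ> f has_derivative (frechet_derivative g (at (f x)) \<circ> frechet_derivative f (at x))) (at x)"
      using Suc.prems x by (intro diff_chain_at has_derivative_frechet) auto
    then show "(g \<circ> f has_derivative (\<lambda>v. \<Sum>b\<in>Basis. (?Df x v \<bullet> b) *\<^sub>R (?Dg b \<circ> f) x)) (at x)"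
      using expand[OF x] by (simp add: o_def)
  next
    fix v
    show "Ck_on k S (\<lambda>x. \<Sum>b\<in>Basis. (?Df x v \<bullet> b) *\<^sub>R (?Dg b \<circ> f) x)"
      using Suc.prems Ck_on_SucD[OF Suc.prems(1)]
      by (intro Ck_on_sum Ck_on_bounded_bilinear[OF bounded_bilinear_scaleR]
          Ck_on_bounded_linear[OF bounded_linear_inner_left] Suc.IH assms) auto
  qed (use assms in auto)
qed

lemma smooth_on_subset: "smooth_on S f \<Longrightarrow> T \<subseteq> S \<Longrightarrow> smooth_on T f"
  by (auto simp: smooth_on_def intro: Ck_on_subset)

lemma smooth_on_cong:
  "\<lbrakk>smooth_on S f; open S; \<And>x. x \<in> S \<Longrightarrow> f x = g x\<rbrakk> \<Longrightarrow> smooth_on S g"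
  by (auto simp: smooth_on_def intro: Ck_on_cong)

lemma smooth_on_const: "open S \<Longrightarrow> smooth_on S (\<lambda>x. c)"
  by (auto simp: smooth_on_def intro: Ck_on_const)

lemma smooth_on_add:
  "\<lbrakk>open S; smooth_on S f; smooth_on S g\<rbrakk> \<Longrightarrow> smooth_on S (\<lambda>x. f x + g x)"
  by (auto simp: smooth_on_def intro: Ck_on_add)

lemma smooth_on_bounded_linear:
  "\<lbrakk>bounded_linear L; open S; smooth_on S f\<rbrakk> \<Longrightarrow> smooth_on S (\<lambda>x. L (f x))"
  by (auto simp: smooth_on_def intro: Ck_on_bounded_linear)

lemma smooth_on_bounded_bilinear:
  "\<lbrakk>bounded_bilinear B; open S; smooth_on S f; smooth_on S g\<rbrakk> \<Longrightarrow> smooth_on S (\<lambda>x. B (f x) (g x))"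
  by (auto simp: smooth_on_def intro: Ck_on_bounded_bilinear)

lemma smooth_on_inverse:
  fixes f :: "'a::euclidean_space \<Rightarrow> real"
  shows "\<lbrakk>open S; smooth_on S f; \<And>x. x \<in> S \<Longrightarrow> f x \<noteq> 0\<rbrakk> \<Longrightarrow> smooth_on S (\<lambda>x. inverse (f x))"
  by (auto simp: smooth_on_def intro: Ck_on_inverse)

lemma smooth_on_compose:
  "\<lbrakk>open S; open R; smooth_on S f; smooth_on R g; f ` S \<subseteq> R\<rbrakk> \<Longrightarrow> smooth_on S (g \<circ> f)"
  by (auto simp: smooth_on_def intro: Ck_on_compose)

lemma smooth_on_imp_differentiable: "smooth_on S f \<Longrightarrow> x \<in> S \<Longrightarrow> f differentiable (at x)"
  by (metis Ck_on.simps(2) smooth_on_def)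

lemma smooth_on_frechet_derivative: "smooth_on S f \<Longrightarrow> smooth_on S (\<lambda>x. frechet_derivative f (at x) v)"
  by (metis Ck_on.simps(2) smooth_on_def)

lemma smooth_on_has_vector_derivative:
  fixes f :: "real \<Rightarrow> 'b::euclidean_space"
  assumes "smooth_on S f" "t \<in> S"
  shows "(f has_vector_derivative vector_derivative f (at t)) (at t)"
  using smooth_on_imp_differentiable[OF assms] by (simp only: vector_derivative_works)

lemma smooth_on_vector_derivative:
  fixes f :: "real \<Rightarrow> 'b::euclidean_space"
  assumes "open S" "smooth_on S f"
  shows "smooth_on S (\<lambda>t. vector_derivative f (at t))"
  by (rule smooth_on_cong[OF smooth_on_frechet_derivative[OF assms(2), of 1] assms(1)])
     (use assms(2) in \<open>simp add: frechet_derivative_eq_vector_derivative smooth_on_imp_differentiable\<close>)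

lemma second_derivative_reparameterization:
  fixes a b :: "real \<Rightarrow> 'b::euclidean_space" and h :: "real \<Rightarrow> real"
  assumes I: "open I" "t \<in> I" and J: "open J" and sm: "smooth_on I h" "smooth_on J b"
    and ab: "\<And>s. s \<in> I \<Longrightarrow> h s \<in> J \<and> a s = b (h s)"
  defines "h' \<equiv> \<lambda>s. vector_derivative h (at s)" and "b' \<equiv> \<lambda>s. vector_derivative b (at s)"
  shows "vector_derivative a (at t) = h' t *\<^sub>R b' (h t)"
    and "vector_derivative (\<lambda>s. vector_derivative a (at s)) (at t) =
           (h' t)\<^sup>2 *\<^sub>R vector_derivative b' (at (h t)) + vector_derivative h' (at t) *\<^sub>R b' (h t)"
proof -
  have a': "vector_derivative a (at s) = h' s *\<^sub>R b' (h s)" if s: "s \<in> I" for s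
  proof -
    have "(b \<circ> h has_vector_derivative h' s *\<^sub>R b' (h s)) (at s)"
      unfolding h'_def b'_def using s ab sm by (intro vector_diff_chain_at smooth_on_has_vector_derivative) auto
    then have "(a has_vector_derivative h' s *\<^sub>R b' (h s)) (at s)"
      by (rule has_vector_derivative_transform_within_open[OF _ I(1) s]) (use ab in auto)
    then show ?thesis by (rule vector_derivative_at)
  qed
  then show "vector_derivative a (at t) = h' t *\<^sub>R b' (h t)" using I by blast
  have b'': "((\<lambda>s. b' (h s)) has_vector_derivative h' t *\<^sub>R vector_derivative b' (at (h t))) (at t)"
    using vector_diff_chain_at[OF smooth_on_has_vector_derivative[OF sm(1) I(2)]
        smooth_on_has_vector_derivative[OF smooth_on_vector_derivative[OF J sm(2)]]] ab[OF I(2)]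
    by (simp add: o_def h'_def b'_def)
  have h'': "(h' has_vector_derivative vector_derivative h' (at t)) (at t)"
    unfolding h'_def by (rule smooth_on_has_vector_derivative[OF smooth_on_vector_derivative[OF I(1) sm(1)] I(2)])
  have "((\<lambda>s. h' s *\<^sub>R b' (h s)) has_vector_derivative
      h' t *\<^sub>R (h' t *\<^sub>R vector_derivative b' (at (h t))) + vector_derivative h' (at t) *\<^sub>R b' (h t)) (at t)"
    using h'' b'' by (intro has_vector_derivative_scaleR) (simp_all add: has_real_derivative_iff_has_vector_derivative)
  then have "((\<lambda>s. vector_derivative a (at s)) has_vector_derivative
      h' t *\<^sub>R (h' t *\<^sub>R vector_derivative b' (at (h t))) + vector_derivative h' (at t) *\<^sub>R b' (h t)) (at t)"
    by (rule has_vector_derivative_transform_within_open[OF _ I]) (simp add: a')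
  from vector_derivative_at[OF this]
  show "vector_derivative (\<lambda>s. vector_derivative a (at s)) (at t) =
           (h' t)\<^sup>2 *\<^sub>R vector_derivative b' (at (h t)) + vector_derivative h' (at t) *\<^sub>R b' (h t)"
    by (simp add: power2_eq_square)
qed

section \<open>Symmetry of second derivatives\<close>

text \<open>The mixed second difference of \<open>f\<close>, divided by \<open>h\<^sup>2\<close>, tends to the derivative in direction
  \<open>v\<close> of the derivative in direction \<open>u\<close>: the mean value theorem in direction \<open>u\<close> turns it into a
  difference quotient of the latter in direction \<open>v\<close>.\<close>

lemma tendsto_second_difference:
  fixes f :: "'a::euclidean_space \<Rightarrow> real"
  assumes S: "open S" "x \<in> S" and f: "\<And>y. y \<in> S \<Longrightarrow> (f has_derivative f' y) (at y)"
    and A: "((\<lambda>y. f' y u) has_derivative A) (at x)"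
  shows "((\<lambda>h. (f (x + h *\<^sub>R u + h *\<^sub>R v) - f (x + h *\<^sub>R u) - f (x + h *\<^sub>R v) + f x) / h\<^sup>2) \<longlongrightarrow> A v)
           (at_right 0)"
proof (rule tendstoI)
  fix e :: real assume e: "e > 0"
  define K where "K = 2 * (norm u + norm v) + 1"
  have K: "K > 0" by (simp add: K_def add_nonneg_pos)
  define \<epsilon> where "\<epsilon> = e / (2 * K)"
  have \<epsilon>: "\<epsilon> > 0" using e K by (simp add: \<epsilon>_def)
  obtain d where d: "d > 0" and dS: "ball x d \<subseteq> S"
    using S openE by blast
  obtain d' where d': "d' > 0" and dA: "\<And>y. norm (y - x) < d' \<Longrightarrow>
      norm (f' y u - f' x u - A (y - x)) \<le> \<epsilon> * norm (y - x)"
    using A \<epsilon> unfolding has_derivative_at_alt by blast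
  interpret A: linear A using A has_derivative_linear by blast
  define \<delta> where "\<delta> = min d d' / K"
  have \<delta>: "\<delta> > 0" using d d' K by (simp add: \<delta>_def)
  have "dist ((f (x + h *\<^sub>R u + h *\<^sub>R v) - f (x + h *\<^sub>R u) - f (x + h *\<^sub>R v) + f x) / h\<^sup>2) (A v) < e"
    if h: "0 < h" "h < \<delta>" for h
  proof -
    have hK: "h * K < min d d'" using h K by (simp add: \<delta>_def pos_less_divide_eq)
    have near: "norm (s *\<^sub>R u + t *\<^sub>R v) \<le> h * (norm u + norm v)"
      if "0 \<le> s" "s \<le> h" "0 \<le> t" "t \<le> h" for s t
    proof -
      have "norm (s *\<^sub>R u + t *\<^sub>R v) \<le> s * norm u + t * norm v"
        using that norm_triangle_ineq[of "s *\<^sub>R u" "t *\<^sub>R v"] by simp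
      also have "\<dots> \<le> h * norm u + h * norm v"
        using that by (intro add_mono mult_right_mono) auto
      finally show ?thesis by (simp add: algebra_simps)
    qed
    have lt: "h * (norm u + norm v) < min d d'"
    proof -
      have "h * (norm u + norm v) \<le> h * K"
        using h by (intro mult_left_mono) (auto simp: K_def)
      with hK show ?thesis by linarith
    qed
    have inS: "x + s *\<^sub>R u + t *\<^sub>R v \<in> S" if "0 \<le> s" "s \<le> h" "0 \<le> t" "t \<le> h" for s t
      using near[OF that] lt dS by (intro subsetD[OF dS]) (auto simp: dist_norm norm_minus_commute algebra_simps)
    define \<phi> where "\<phi> s = f (x + s *\<^sub>R u + h *\<^sub>R v) - f (x + s *\<^sub>R u)" for s
    have lin: "linear (f' y)" if "y \<in> S" for y using f[OF that] has_derivative_linear by blast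
    have line: "((\<lambda>s. f (y + s *\<^sub>R u)) has_real_derivative f' (y + s *\<^sub>R u) u) (at s)"
      if "y + s *\<^sub>R u \<in> S" for y s
    proof -
      have "((\<lambda>s. y + s *\<^sub>R u) has_derivative (\<lambda>r. r *\<^sub>R u)) (at s)"
        by (auto intro!: derivative_eq_intros)
      from diff_chain_at[OF this f[OF that]]
      have "((\<lambda>s. f (y + s *\<^sub>R u)) has_derivative (\<lambda>r. f' (y + s *\<^sub>R u) (r *\<^sub>R u))) (at s)"
        by (simp add: o_def)
      then show ?thesis
        by (simp add: has_field_derivative_def linear_scale[OF lin[OF that]] mult_commute_abs)
    qed
    have "(\<phi> has_real_derivative f' (x + s *\<^sub>R u + h *\<^sub>R v) u - f' (x + s *\<^sub>R u) u) (at s)"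
      if "0 \<le> s" "s \<le> h" for s
    proof -
      have "x + h *\<^sub>R v + s *\<^sub>R u \<in> S" "x + s *\<^sub>R u \<in> S"
        using inS[of s h] inS[of s 0] that h by (auto simp: algebra_simps)
      from DERIV_diff[OF line[OF this(1)] line[OF this(2)]] show ?thesis
        unfolding \<phi>_def by (simp add: algebra_simps)
    qed
    from MVT2[OF h(1) this] obtain s where s: "0 < s" "s < h"
      and mv: "\<phi> h - \<phi> 0 = h * (f' (x + s *\<^sub>R u + h *\<^sub>R v) u - f' (x + s *\<^sub>R u) u)"
      by auto
    define g where "g y = f' y u - f' x u - A (y - x)" for y
    have gle: "\<bar>g (x + (s *\<^sub>R u + t *\<^sub>R v))\<bar> \<le> \<epsilon> * (h * (norm u + norm v))" if "0 \<le> t" "t \<le> h" for t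
    proof -
      note n = near[of s t] 
      have "norm (g (x + (s *\<^sub>R u + t *\<^sub>R v))) \<le> \<epsilon> * norm (s *\<^sub>R u + t *\<^sub>R v)"
        unfolding g_def using dA[of "x + (s *\<^sub>R u + t *\<^sub>R v)"] n s that lt by simp
      also have "\<dots> \<le> \<epsilon> * (h * (norm u + norm v))"
        using n s that \<epsilon> by (intro mult_left_mono) auto
      finally show ?thesis by simp
    qed
    define G where "G = g (x + (s *\<^sub>R u + h *\<^sub>R v)) - g (x + (s *\<^sub>R u + 0 *\<^sub>R v))"
    have "\<phi> h - \<phi> 0 = h * (h * A v + G)"
      unfolding mv g_def G_def by (simp add: A.add A.scale add.assoc)
    then have "(\<phi> h - \<phi> 0) / h\<^sup>2 - A v = G / h"
      using h by (simp add: field_simps power2_eq_square)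
    also have "\<bar>\<dots>\<bar> \<le> (2 * (\<epsilon> * (h * (norm u + norm v)))) / h"
    proof -
      have "\<bar>G\<bar> \<le> 2 * (\<epsilon> * (h * (norm u + norm v)))"
        using gle[of h] gle[of 0] h unfolding G_def by linarith
      then show ?thesis using h by (simp only: abs_divide abs_of_pos) (simp only: divide_right_mono less_imp_le)
    qed
    also have "\<dots> = \<epsilon> * (2 * (norm u + norm v))" using h by simp
    also have "\<dots> \<le> \<epsilon> * K" using \<epsilon> by (intro mult_left_mono) (auto simp: K_def)
    also have "\<dots> < e" using e K by (simp add: \<epsilon>_def)
    finally show ?thesis
      by (simp add: \<phi>_def dist_real_def algebra_simps)
  qed
  then show "\<forall>\<^sub>F h in at_right 0. dist ((f (x + h *\<^sub>R u + h *\<^sub>R v) - f (x + h *\<^sub>R u) -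
      f (x + h *\<^sub>R v) + f x) / h\<^sup>2) (A v) < e"
    using \<delta> unfolding eventually_at_right_field by auto
qed

lemma symmetric_second_derivative_real:
  fixes f :: "'a::euclidean_space \<Rightarrow> real"
  assumes S: "open S" "x \<in> S" and f: "\<And>y. y \<in> S \<Longrightarrow> (f has_derivative f' y) (at y)"
    and A: "((\<lambda>y. f' y u) has_derivative A) (at x)"
    and B: "((\<lambda>y. f' y v) has_derivative B) (at x)"
  shows "A v = B u"
proof (rule tendsto_unique[OF _ tendsto_second_difference[OF S f A, of v]])
  show "((\<lambda>h. (f (x + h *\<^sub>R u + h *\<^sub>R v) - f (x + h *\<^sub>R u) - f (x + h *\<^sub>R v) + f x) / h\<^sup>2) \<longlongrightarrow> B u) (at_right 0)"
    using tendsto_second_difference[OF S f B, of u] by (simp add: algebra_simps)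
qed simp

lemma symmetric_second_derivative:
  assumes "open S" "x \<in> S" "smooth_on S f"
  shows "frechet_derivative (\<lambda>y. frechet_derivative f (at y) u) (at x) v =
         frechet_derivative (\<lambda>y. frechet_derivative f (at y) v) (at x) u"
proof (rule euclidean_eqI)
  fix b :: 'b
  have D: "((\<lambda>y. frechet_derivative f (at y) w \<bullet> b) has_derivative
      (\<lambda>z. frechet_derivative (\<lambda>y. frechet_derivative f (at y) w) (at x) z \<bullet> b)) (at x)" for w
    using smooth_on_imp_differentiable[OF smooth_on_frechet_derivative[OF assms(3)] assms(2)]
    by (intro bounded_linear.has_derivative[OF bounded_linear_inner_left] has_derivative_frechet)
  have f: "((\<lambda>y. f y \<bullet> b) has_derivative (\<lambda>z. frechet_derivative f (at y) z \<bullet> b)) (at y)" if "y \<in> S" for y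
    using smooth_on_imp_differentiable[OF assms(3) that]
    by (intro bounded_linear.has_derivative[OF bounded_linear_inner_left] has_derivative_frechet)
  show "frechet_derivative (\<lambda>y. frechet_derivative f (at y) u) (at x) v \<bullet> b =
        frechet_derivative (\<lambda>y. frechet_derivative f (at y) v) (at x) u \<bullet> b"
    by (rule symmetric_second_derivative_real[OF assms(1,2) f D D])
qed

section \<open>Torsion-type tensors at a point\<close>

text \<open>Homogeneity is clear from \<open>B (a u) (a u) = a\<^sup>2 B u u\<close> and gives additivity on dependent vectors.
  For independent ones, compare coefficients in the parallelogram identity
  \<open>B (u+v) (u+v) + B (u-v) (u-v) = 2 B u u + 2 B v v\<close>.\<close>

lemma eigen_quadratic_map_coefficient_linear:
  fixes B :: "'a::real_inner \<Rightarrow> 'a \<Rightarrow> 'a"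
  assumes "bilinear B" "subspace H" and eig: "\<And>u. u \<in> H \<Longrightarrow> B u u \<in> span {u}"
  obtains c where "\<And>u. u \<in> H \<Longrightarrow> B u u = c u *\<^sub>R u"
    and "\<And>u v. \<lbrakk>u \<in> H; v \<in> H\<rbrakk> \<Longrightarrow> c (u + v) = c u + c v"
    and "\<And>a u. u \<in> H \<Longrightarrow> c (a *\<^sub>R u) = a * c u"
proof -
  note bil = bilinear_ladd[OF assms(1)] bilinear_radd[OF assms(1)] bilinear_lmul[OF assms(1)]
    bilinear_rmul[OF assms(1)] bilinear_lneg[OF assms(1)] bilinear_rneg[OF assms(1)]
    bilinear_lsub[OF assms(1)] bilinear_rsub[OF assms(1)]
  define c where "c u = (B u u \<bullet> u) / (u \<bullet> u)" for u
  have c: "B u u = c u *\<^sub>R u" if "u \<in> H" for u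
    using eig[OF that] by (auto simp: span_singleton c_def)
  have c0: "c 0 = 0" by (simp add: c_def)
  have hom: "c (a *\<^sub>R u) = a * c u" if "u \<in> H" for a u
    by (simp add: c_def bil)
  have add: "c (u + v) = c u + c v" if u: "u \<in> H" and v: "v \<in> H" for u v
  proof (cases "v \<in> span {u}")
    case True
    then obtain k where "v = k *\<^sub>R u" by (auto simp: span_singleton)
    then show ?thesis using hom[OF u] hom[OF u, of "1 + k"] by (simp add: algebra_simps)
  next
    case False
    let ?s = "c (u + v)" and ?d = "c (u - v)"
    have "B (u + v) (u + v) + B (u - v) (u - v) = 2 *\<^sub>R B u u + 2 *\<^sub>R B v v"
      by (simp add: bil algebra_simps scaleR_2)
    then have "(?s - ?d - 2 * c v) *\<^sub>R v = (2 * c u - ?s - ?d) *\<^sub>R u"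
      using c[OF subspace_add[OF assms(2) u v]] c[OF subspace_diff[OF assms(2) u v]] c[OF u] c[OF v]
      by (simp add: algebra_simps scaleR_2)
    have *: "k = 0" if "k *\<^sub>R v = l *\<^sub>R u" for k l
    proof (rule ccontr)
      assume "k \<noteq> 0"
      then have "v = (l / k) *\<^sub>R u" using that by (metis scaleR_scaleR divide_inverse_commute
            left_inverse scaleR_one)
      then show False using False by (auto simp: span_singleton)
    qed
    from * \<open>(?s - ?d - 2 * c v) *\<^sub>R v = _\<close> have k: "?s - ?d - 2 * c v = 0" by blast
    show ?thesis
    proof (cases "u = 0")
      case True
      then show ?thesis using c0 by simp
    next
      case u0: False
      have "(2 * c u - ?s - ?d) *\<^sub>R u = 0" using k \<open>(?s - ?d - 2 * c v) *\<^sub>R v = _\<close> by simp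
      then show ?thesis using u0 k by simp
    qed
  qed
  show thesis using that c add hom by blast
qed

lemma lin_trace_rank_one:
  assumes "linear \<phi>"
  shows "lin_trace (\<lambda>v. \<phi> v *\<^sub>R w) = \<phi> w"
proof -
  have "\<phi> w = \<phi> (\<Sum>b\<in>Basis. (w \<bullet> b) *\<^sub>R b)" by (simp add: euclidean_representation)
  also have "\<dots> = (\<Sum>b\<in>Basis. (w \<bullet> b) * \<phi> b)"
    by (simp add: linear_sum[OF assms] linear_scale[OF assms])
  finally show ?thesis by (simp add: lin_trace_def mult.commute)
qed

lemma lin_trace_scaled_identity: "lin_trace (\<lambda>v::'a::euclidean_space. a *\<^sub>R v) = a * DIM('a)"
  by (simp add: lin_trace_def)

lemma lin_trace_add: "lin_trace (\<lambda>v. f v + g v) = lin_trace f + lin_trace g"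
  by (simp add: lin_trace_def inner_add_left sum.distrib)

lemma lin_trace_diff: "lin_trace (\<lambda>v. f v - g v) = lin_trace f - lin_trace g"
  by (simp add: lin_trace_def inner_diff_left sum_subtractf)

text \<open>Adding \<open>\<theta> \<otimes> \<theta>\<close> to \<open>\<omega>\<close> gives a non-degenerate bilinear form on the whole space, for which
  injectivity of the induced map to the dual implies surjectivity.\<close>

lemma contact_sharp_exists:
  fixes \<theta> :: "'e::euclidean_space \<Rightarrow> real" and \<omega> :: "'e \<Rightarrow> 'e \<Rightarrow> real"
  assumes \<theta>: "linear \<theta>" "\<theta> T = 1"
    and \<omega>: "bilinear \<omega>" "\<And>v. \<omega> T v = 0" "\<And>v. \<omega> v T = 0"
    and nondeg: "\<And>u. \<lbrakk>\<theta> u = 0; \<And>v. \<theta> v = 0 \<Longrightarrow> \<omega> u v = 0\<rbrakk> \<Longrightarrow> u = 0"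
    and \<phi>: "linear \<phi>" "\<phi> T = 0"
  obtains W where "\<theta> W = 0" "\<And>x. \<omega> W x = \<phi> x"
proof -
  let ?q = "\<lambda>v x. \<omega> v x + \<theta> v * \<theta> x"
  have lin: "linear (?q v)" for v
    using \<omega>(1) \<theta>(1)
    by (intro linearI) (simp_all add: bilinear_def linear_add linear_scale algebra_simps)
  define g where "g v = (\<Sum>b\<in>Basis. ?q v b *\<^sub>R b)" for v
  have "linear g"
    unfolding g_def using \<theta>(1) bilinear_ladd[OF \<omega>(1)] bilinear_lmul[OF \<omega>(1)]
    by (intro linearI) (simp_all add: linear_add linear_scale algebra_simps scaleR_sum_right sum.distrib)
  have g: "g v \<bullet> x = ?q v x" for v x
  proof -
    have "?q v x = ?q v (\<Sum>b\<in>Basis. (x \<bullet> b) *\<^sub>R b)" by (simp add: euclidean_representation)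
    also have "\<dots> = (\<Sum>b\<in>Basis. (x \<bullet> b) * ?q v b)"
      by (simp only: linear_sum[OF lin[of v]] linear_scale[OF lin[of v]] o_def real_scaleR_def)
    finally show ?thesis by (simp add: g_def inner_sum_left inner_commute[of x] mult.commute)
  qed
  have "inj g"
  proof (subst linear_injective_0[OF \<open>linear g\<close>], intro allI impI)
    fix v assume "g v = 0"
    then have q0: "?q v x = 0" for x using g[of v x] by simp
    then have "\<theta> v = 0" using \<theta>(2) \<omega>(3) by (metis add_0 mult.right_neutral)
    then show "v = 0" using nondeg q0 by simp
  qed
  then have "surj g" using \<open>linear g\<close> linear_injective_imp_surjective by blast
  then obtain W where W: "g W = (\<Sum>b\<in>Basis. \<phi> b *\<^sub>R b)" by (metis surjD)
  have \<phi>W: "?q W x = \<phi> x" for x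
  proof -
    have "?q W x = (\<Sum>b\<in>Basis. \<phi> b * (x \<bullet> b))"
      unfolding g[symmetric] W by (simp add: inner_sum_left inner_commute[of x])
    also have "\<dots> = \<phi> (\<Sum>b\<in>Basis. (x \<bullet> b) *\<^sub>R b)"
      by (simp add: linear_sum[OF \<phi>(1)] linear_scale[OF \<phi>(1)] mult.commute)
    finally show ?thesis by (simp add: euclidean_representation)
  qed
  have "\<theta> W = 0" using \<phi>W[of T] \<theta>(2) \<phi>(2) \<omega>(3) by simp
  then show thesis using that \<phi>W by simp
qed

text \<open>The linear algebra of the theorem, in one tangent space with \<open>H = ker \<theta>\<close>. The second Reeb vector is
  a multiple of \<open>T + Z\<close>; \<open>\<omega> Z\<close> stands for the logarithmic derivative of the scale factor on \<open>H\<close>.\<close>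

lemma torsion_change_pointwise:
  fixes \<theta> :: "'e::euclidean_space \<Rightarrow> real" and \<omega> :: "'e \<Rightarrow> 'e \<Rightarrow> real"
    and \<Lambda> \<tau> \<tau>' :: "'e \<Rightarrow> 'e \<Rightarrow> 'e"
  assumes \<theta>: "linear \<theta>" "\<theta> T = 1"
    and \<omega>: "bilinear \<omega>" "\<And>u v. \<omega> u v = - \<omega> v u" "\<And>v. \<omega> T v = 0"
    and nondeg: "\<And>u. \<lbrakk>\<theta> u = 0; \<And>v. \<theta> v = 0 \<Longrightarrow> \<omega> u v = 0\<rbrakk> \<Longrightarrow> u = 0"
    and \<tau>: "bilinear \<tau>" "\<And>v. \<tau> v T = 0" "\<And>v. lin_trace (\<tau> v) = 0"
    and \<tau>': "bilinear \<tau>'" "\<And>v. \<tau>' v (T + Z) = 0" "\<And>v. lin_trace (\<tau>' v) = 0"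
    and Z: "\<theta> Z = 0"
    and \<theta>\<tau>': "\<And>u v. \<lbrakk>\<theta> u = 0; \<theta> v = 0\<rbrakk> \<Longrightarrow> \<theta> (\<tau>' u v) = \<omega> u v"
    and \<Lambda>: "bilinear \<Lambda>" "\<And>u v. \<Lambda> u v - \<Lambda> v u = \<tau>' u v - \<tau> u v"
    and \<theta>\<Lambda>: "\<And>u v. \<theta> v = 0 \<Longrightarrow> \<theta> (\<Lambda> u v) = 0"
    and eig: "\<And>u. \<theta> u = 0 \<Longrightarrow> \<Lambda> u u \<in> span {u}"
    and \<omega>\<Lambda>: "\<And>u v w. \<lbrakk>\<theta> u = 0; \<theta> v = 0; \<theta> w = 0\<rbrakk> \<Longrightarrow>
        \<omega> Z v * \<omega> u w = \<omega> (\<Lambda> v u) w + \<omega> u (\<Lambda> v w)"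
    and uv: "\<theta> u = 0" "\<theta> v = 0"
  shows "\<tau>' u v - \<tau> u v = \<omega> u v *\<^sub>R Z"
proof -
  let ?H = "{v. \<theta> v = 0}"
  note lin\<theta> = linear_add[OF \<theta>(1)] linear_diff[OF \<theta>(1)] linear_scale[OF \<theta>(1)] linear_0[OF \<theta>(1)]
  note bil\<omega> = bilinear_ladd[OF \<omega>(1)] bilinear_radd[OF \<omega>(1)] bilinear_lmul[OF \<omega>(1)]
    bilinear_rmul[OF \<omega>(1)] bilinear_lsub[OF \<omega>(1)] bilinear_rsub[OF \<omega>(1)]
  have \<omega>T: "\<omega> v T = 0" for v using \<omega>(2)[of v T] \<omega>(3) by simp
  have lin\<omega>: "linear (\<omega> v)" for v using \<omega>(1) by (simp add: bilinear_def)
  have subH: "subspace ?H" by (auto simp: subspace_def lin\<theta>)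
  define S where "S u v = \<tau>' u v - \<tau> u v" for u v
  have bilS: "S u (v + w) = S u v + S u w" "S u (a *\<^sub>R v) = a *\<^sub>R S u v"
    for u v w a
    by (simp_all add: S_def bilinear_radd[OF \<tau>(1)] bilinear_radd[OF \<tau>'(1)] bilinear_rmul[OF \<tau>(1)]
        bilinear_rmul[OF \<tau>'(1)] algebra_simps)
  have skewS: "S u v = - S v u" for u v using \<Lambda>(2)[of u v] \<Lambda>(2)[of v u] unfolding S_def
    by (metis minus_diff_eq)

  \<comment> \<open>The common geodesics fix the symmetric part of \<open>\<Lambda>\<close> on \<open>H\<close> up to a one-form \<open>\<alpha>\<close>.\<close>
  obtain c where c: "\<And>u. u \<in> ?H \<Longrightarrow> \<Lambda> u u = c u *\<^sub>R u"
    "\<And>u v. \<lbrakk>u \<in> ?H; v \<in> ?H\<rbrakk> \<Longrightarrow> c (u + v) = c u + c v" "\<And>a u. u \<in> ?H \<Longrightarrow> c (a *\<^sub>R u) = a * c u"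
    using eigen_quadratic_map_coefficient_linear[OF \<Lambda>(1) subH] eig by blast
  define P where "P v = v - \<theta> v *\<^sub>R T" for v
  have PH: "\<theta> (P v) = 0" for v by (simp add: P_def lin\<theta> \<theta>(2))
  have P_id: "P v = v" if "\<theta> v = 0" for v using that by (simp add: P_def)
  have P_lin: "P (u + v) = P u + P v" "P (a *\<^sub>R u) = a *\<^sub>R P u" for u v a
    by (simp_all add: P_def lin\<theta> algebra_simps)
  define \<alpha> where "\<alpha> v = c (P v)" for v
  have \<alpha>: "linear \<alpha>" by (intro linearI) (simp_all add: \<alpha>_def P_lin c PH)
  have \<alpha>T: "\<alpha> T = 0" using c(3)[of 0 0] by (simp add: \<alpha>_def P_def \<theta>(2) lin\<theta>)
  have sym: "\<Lambda> u v + \<Lambda> v u = \<alpha> u *\<^sub>R v + \<alpha> v *\<^sub>R u" if "\<theta> u = 0" "\<theta> v = 0" for u v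
  proof -
    have "\<Lambda> (u + v) (u + v) = (\<alpha> u + \<alpha> v) *\<^sub>R (u + v)"
      using that c(1,2) by (simp add: \<alpha>_def P_id lin\<theta>)
    moreover have "\<Lambda> u u = \<alpha> u *\<^sub>R u" "\<Lambda> v v = \<alpha> v *\<^sub>R v"
      using that c(1) by (simp_all add: \<alpha>_def P_id)
    ultimately show ?thesis
      by (simp add: bilinear_ladd[OF \<Lambda>(1)] bilinear_radd[OF \<Lambda>(1)] algebra_simps)
  qed
  define \<gamma> where "\<gamma> v = \<omega> Z v" for v
  define \<beta> where "\<beta> v = \<gamma> v - \<alpha> v" for v
  have lin\<beta>: "linear \<beta>" unfolding \<beta>_def[abs_def] \<gamma>_def using \<alpha> lin\<omega> by (intro linear_compose_sub)
  have \<beta>T: "\<beta> T = 0" by (simp add: \<beta>_def \<gamma>_def \<omega>T \<alpha>T)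

  \<comment> \<open>Compatibility with the two-forms determines the skew part of \<open>\<Lambda>\<close> from \<open>\<alpha>\<close> and \<open>\<gamma>\<close>, by the
    same permutation of indices that gives the Koszul formula.\<close>
  have two\<Lambda>: "2 *\<^sub>R \<Lambda> u v = \<alpha> u *\<^sub>R v + \<alpha> v *\<^sub>R u + S u v" if "\<theta> u = 0" "\<theta> v = 0" for u v
    using sym[OF that] \<Lambda>(2)[of u v] unfolding S_def scaleR_2 by (simp add: algebra_simps)
  have skew_part: "\<omega> (S x y) z - \<omega> (S x z) y
      = 2 * \<gamma> x * \<omega> y z - 2 * \<alpha> x * \<omega> y z - \<alpha> y * \<omega> x z + \<alpha> z * \<omega> x y"
    if "\<theta> x = 0" "\<theta> y = 0" "\<theta> z = 0" for x y z
  proof -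
    have "2 * (\<gamma> x * \<omega> y z) = \<omega> (2 *\<^sub>R \<Lambda> x y) z - \<omega> (2 *\<^sub>R \<Lambda> x z) y"
      using \<omega>\<Lambda>[of y x z] that \<omega>(2)[of y "\<Lambda> x z"] by (simp add: \<gamma>_def bil\<omega>)
    then show ?thesis
      using \<omega>(2)[of z y] by (simp add: two\<Lambda> that bil\<omega> algebra_simps)
  qed
  have "linear (\<lambda>x. 2 * \<alpha> x - \<gamma> x)"
    unfolding \<gamma>_def using linear_add[OF \<alpha>] linear_scale[OF \<alpha>]
    by (intro linearI) (simp_all add: bil\<omega> algebra_simps)
  moreover have "2 * \<alpha> T - \<gamma> T = 0" by (simp add: \<alpha>T \<gamma>_def \<omega>T)
  ultimately obtain W where W: "\<theta> W = 0" "\<And>x. \<omega> W x = 2 * \<alpha> x - \<gamma> x"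
    using contact_sharp_exists[OF \<theta> \<omega>(1) \<omega>(3) \<omega>T nondeg] by blast
  have S_eq: "S u v = \<omega> u v *\<^sub>R W + \<beta> u *\<^sub>R v - \<beta> v *\<^sub>R u" if H: "\<theta> u = 0" "\<theta> v = 0" for u v
  proof -
    let ?R = "\<omega> u v *\<^sub>R W + \<beta> u *\<^sub>R v - \<beta> v *\<^sub>R u"
    have "\<theta> (S u v) = 0"
      using \<theta>\<Lambda> H \<Lambda>(2)[of u v] unfolding S_def by (metis diff_zero lin\<theta>(2))
    moreover have "\<theta> ?R = 0" by (simp add: lin\<theta> H W)
    moreover have "\<omega> (S u v) x = \<omega> ?R x" if x: "\<theta> x = 0" for x
    proof -
      note skew_part[OF H x] skew_part[OF H(2) x H(1)] skew_part[OF x H]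
      moreover have "\<omega> (S v u) x = - \<omega> (S u v) x" "\<omega> (S x u) v = - \<omega> (S u x) v"
        "\<omega> (S v x) u = - \<omega> (S x v) u"
        using skewS[of v u] skewS[of x u] skewS[of v x] bilinear_lneg[OF \<omega>(1)] by auto
      moreover have "\<omega> ?R x = \<omega> u v * (2 * \<alpha> x - \<gamma> x) + \<beta> u * \<omega> v x - \<beta> v * \<omega> u x"
        by (simp add: bil\<omega> W)
      ultimately show ?thesis
        using \<omega>(2)[of v u] \<omega>(2)[of x u] \<omega>(2)[of x v] by (simp add: \<beta>_def algebra_simps)
    qed
    ultimately have "S u v - ?R = 0"
      using linear_diff[OF \<theta>(1), of "S u v" ?R] bilinear_lsub[OF \<omega>(1), of "S u v" ?R]
      by (intro nondeg) simp_all
    then show ?thesis by simp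
  qed

  \<comment> \<open>The trace conditions concern \<open>S y\<close> on all tangent vectors; its value at \<open>T\<close> comes from
    \<open>\<tau> y T = 0\<close> and \<open>\<tau>' y (T + Z) = 0\<close>.\<close>
  have \<beta>0: "\<beta> y = 0" if y: "\<theta> y = 0" for y
  proof -
    have ST: "S y T = - \<tau>' y Z"
      using \<tau>'(2)[of y] \<tau>(2)[of y] by (simp add: S_def bilinear_radd[OF \<tau>'(1)] eq_neg_iff_add_eq_0)
    have Sv: "S y v = \<omega> y v *\<^sub>R W + \<beta> y *\<^sub>R v - \<beta> v *\<^sub>R y - \<theta> v *\<^sub>R (\<beta> y *\<^sub>R T + \<tau>' y Z)" for v
    proof -
      have "v = P v + \<theta> v *\<^sub>R T" by (simp add: P_def)
      then have "S y v = S y (P v) + \<theta> v *\<^sub>R S y T" by (metis bilS)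
      moreover have "\<omega> y (P v) = \<omega> y v" "\<beta> (P v) = \<beta> v"
        by (simp_all add: P_def bil\<omega> \<omega>T linear_diff[OF lin\<beta>] linear_scale[OF lin\<beta>] \<beta>T)
      ultimately show ?thesis by (simp add: S_eq[OF y PH] ST) (simp add: P_def algebra_simps)
    qed
    have "lin_trace (S y) = \<omega> y W + \<beta> y * DIM('e) - \<beta> y - \<theta> (\<beta> y *\<^sub>R T + \<tau>' y Z)"
      by (subst ext[of "S y", OF Sv])
         (simp add: lin_trace_diff lin_trace_add lin_trace_rank_one[OF lin\<omega>] lin_trace_rank_one[OF lin\<beta>]
          lin_trace_rank_one[OF \<theta>(1)] lin_trace_scaled_identity)
    moreover have "lin_trace (S y) = 0"
      unfolding S_def[abs_def] by (simp add: lin_trace_diff \<tau>(3) \<tau>'(3))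
    moreover have "\<omega> y W = \<gamma> y - 2 * \<alpha> y" using \<omega>(2)[of y W] W(2) by simp
    moreover have "\<theta> (\<beta> y *\<^sub>R T + \<tau>' y Z) = \<beta> y - \<gamma> y"
      using \<omega>(2)[of y Z] by (simp add: lin\<theta> \<theta>(2) \<theta>\<tau>'[OF y Z] \<gamma>_def)
    ultimately have "\<beta> y * DIM('e) = 0" by (simp add: \<beta>_def)
    then show ?thesis by simp
  qed
  have "W - Z = 0"
  proof (rule nondeg)
    show "\<omega> (W - Z) x = 0" if "\<theta> x = 0" for x
      using \<beta>0[OF that] W(2)[of x] by (simp add: bil\<omega> \<beta>_def \<gamma>_def)
  qed (simp add: lin\<theta> W Z)
  then show ?thesis using S_eq[OF uv] \<beta>0 uv by (simp add: S_def)
qed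

section \<open>Charts and changes of coordinates\<close>

text \<open>The field with constant components \<open>v\<close> in an arbitrary chart \<open>c\<close>. Smoothness on an open set is
  tested in one chart, whereas the fields \<open>extend M p v\<close> belong to the preferred chart at \<open>p\<close>.\<close>

definition chart_frame ::
    "('m, 'e::euclidean_space) manifold \<Rightarrow> ('m, 'e) chart \<Rightarrow> 'e \<Rightarrow> 'm \<Rightarrow> 'e" where
  "chart_frame M c v q = coord_change c (chart_at M q) q v"

lemma extend_eq_chart_frame: "extend M p v = chart_frame M (chart_at M p) v"
  by (simp add: fun_eq_iff extend_def chart_frame_def)

locale smooth_mfd =
  fixes M :: "('m::{t2_space, second_countable_topology}, 'e::euclidean_space) manifold"
  assumes smooth_manifold: "smooth_manifold M"
begin

lemma chart_at [simp, intro]: "chart_at M p \<in> atlas M" "p \<in> fst (chart_at M p)"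
  using smooth_manifold unfolding smooth_manifold_def by blast+

lemma open_domain [simp, intro]: "c \<in> atlas M \<Longrightarrow> open (fst c)"
  using smooth_manifold unfolding smooth_manifold_def by blast

lemma chart_homeomorphism:
  "c \<in> atlas M \<Longrightarrow> homeomorphism (fst c) (snd c ` fst c) (snd c) (chart_inv c)"
  using smooth_manifold unfolding smooth_manifold_def by blast

lemma chart_inv_chart [simp]: "c \<in> atlas M \<Longrightarrow> q \<in> fst c \<Longrightarrow> chart_inv c (snd c q) = q"
  by (meson chart_homeomorphism homeomorphism_apply1)

lemma open_chart_image:
  assumes c: "c \<in> atlas M" and "open W" "W \<subseteq> fst c"
  shows "open (snd c ` W)"
proof -
  have "snd c ` W = {y \<in> snd c ` fst c. chart_inv c y \<in> W}"
    using assms by (force simp: subset_iff)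
  moreover have "openin (top_of_set (snd c ` fst c)) {y \<in> snd c ` fst c. chart_inv c y \<in> W}"
    using continuous_openin_preimage_gen[OF homeomorphism_cont2[OF chart_homeomorphism[OF c]] \<open>open W\<close>]
    by (simp add: vimage_def Int_def)
  moreover have "open (snd c ` fst c)"
    using smooth_manifold c unfolding smooth_manifold_def by blast
  ultimately show ?thesis using openin_open_eq by fastforce
qed

lemma open_chart_image_Int [simp, intro]: "c \<in> atlas M \<Longrightarrow> open W \<Longrightarrow> open (snd c ` (W \<inter> fst c))"
  by (intro open_chart_image) auto

lemma smooth_transition:
  "\<lbrakk>c \<in> atlas M; d \<in> atlas M\<rbrakk> \<Longrightarrow> smooth_on (snd c ` (fst c \<inter> fst d)) (snd d \<circ> chart_inv c)"
  using smooth_manifold unfolding smooth_manifold_def by blast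

lemma transition_has_derivative:
  assumes "c \<in> atlas M" "d \<in> atlas M" "q \<in> fst c" "q \<in> fst d"
  shows "(snd d \<circ> chart_inv c has_derivative coord_change c d q) (at (snd c q))"
  unfolding coord_change_def
  using assms smooth_on_imp_differentiable[OF smooth_transition[OF assms(1,2)]]
  by (intro has_derivative_frechet) blast

lemma linear_coord_change:
  "\<lbrakk>c \<in> atlas M; d \<in> atlas M; q \<in> fst c; q \<in> fst d\<rbrakk> \<Longrightarrow> linear (coord_change c d q)"
  using transition_has_derivative has_derivative_linear by blast

lemma chart_change_has_derivative:
  assumes "c \<in> atlas M" "d \<in> atlas M" "q \<in> fst c" "q \<in> fst d"
    and f: "(f \<circ> chart_inv d has_derivative F) (at (snd d q))"
  shows "(f \<circ> chart_inv c has_derivative F \<circ> coord_change c d q) (at (snd c q))"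
proof -
  let ?g = "(f \<circ> chart_inv d) \<circ> (snd d \<circ> chart_inv c)"
  have "(?g has_derivative F \<circ> coord_change c d q) (at (snd c q))"
    using assms by (intro diff_chain_at transition_has_derivative) auto
  moreover have "open (snd c ` (fst d \<inter> fst c))" "snd c q \<in> snd c ` (fst d \<inter> fst c)"
    using assms by auto
  ultimately show ?thesis
    by (rule has_derivative_transform_within_open) (use assms in auto)
qed

lemma coord_change_compose:
  assumes "c \<in> atlas M" "d \<in> atlas M" "e \<in> atlas M" "q \<in> fst c" "q \<in> fst d" "q \<in> fst e"
  shows "coord_change d e q (coord_change c d q v) = coord_change c e q v"
  using has_derivative_unique[OF chart_change_has_derivative[OF assms(1,2,4,5)
      transition_has_derivative[OF assms(2,3,5,6)]] transition_has_derivative[OF assms(1,3,4,6)]]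
  by (simp add: fun_eq_iff)

lemma coord_change_same [simp]:
  assumes "c \<in> atlas M" "q \<in> fst c"
  shows "coord_change c c q v = v"
proof -
  have "((\<lambda>x. x) has_derivative coord_change c c q) (at (snd c q))"
    by (rule has_derivative_transform_within_open[OF transition_has_derivative[OF assms(1,1,2,2)]
          open_chart_image[OF assms(1) open_domain[OF assms(1)] order.refl]])
       (use assms in auto)
  then have "coord_change c c q = (\<lambda>x. x)"
    by (rule has_derivative_unique) (rule has_derivative_ident)
  then show ?thesis by simp
qed

lemma linear_components: "\<lbrakk>c \<in> atlas M; q \<in> fst c\<rbrakk> \<Longrightarrow> linear (components M c q)"
  unfolding components_def[abs_def] using linear_coord_change by simp

lemma components_chart_frame:
  "\<lbrakk>c \<in> atlas M; d \<in> atlas M; q \<in> fst c; q \<in> fst d\<rbrakk> \<Longrightarrow>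
     components M d q (chart_frame M c v q) = coord_change c d q v"
  by (simp add: components_def chart_frame_def coord_change_compose)

lemma chart_frame_components: "\<lbrakk>c \<in> atlas M; q \<in> fst c\<rbrakk> \<Longrightarrow> chart_frame M c (components M c q v) q = v"
  by (simp add: components_def chart_frame_def coord_change_compose)

lemma linear_chart_frame: "\<lbrakk>c \<in> atlas M; q \<in> fst c\<rbrakk> \<Longrightarrow> linear (\<lambda>v. chart_frame M c v q)"
  unfolding chart_frame_def using linear_coord_change by simp

lemma components_self [simp]: "components M (chart_at M p) p v = v"
  by (simp add: components_def)

lemma extend_self [simp]: "extend M p v p = v"
  by (simp add: extend_def)

section \<open>Smooth functions and vector fields\<close>

lemma smooth_fnD:
  "smooth_fn M W f \<Longrightarrow> c \<in> atlas M \<Longrightarrow> smooth_on (snd c ` (W \<inter> fst c)) (\<lambda>x. f (chart_inv c x))"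
  by (simp add: smooth_fn_def o_def)

lemma smooth_vfD:
  "smooth_vf M W X \<Longrightarrow> c \<in> atlas M \<Longrightarrow>
     smooth_on (snd c ` (W \<inter> fst c)) (\<lambda>x. components M c (chart_inv c x) (X (chart_inv c x)))"
  by (simp add: smooth_vf_def o_def)

lemma smooth_fn_subset: "smooth_fn M W f \<Longrightarrow> V \<subseteq> W \<Longrightarrow> smooth_fn M V f"
  unfolding smooth_fn_def by (blast intro: smooth_on_subset)

lemma smooth_vf_subset: "smooth_vf M W X \<Longrightarrow> V \<subseteq> W \<Longrightarrow> smooth_vf M V X"
  unfolding smooth_vf_def by (blast intro: smooth_on_subset)

lemma smooth_vf_cong:
  assumes "smooth_vf M W X" "open W" "\<And>q. q \<in> W \<Longrightarrow> X q = Y q"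
  shows "smooth_vf M W Y"
  unfolding smooth_vf_def
proof
  fix c assume c: "c \<in> atlas M"
  have "smooth_on (snd c ` (W \<inter> fst c)) ((\<lambda>q. components M c q (X q)) \<circ> chart_inv c)"
    using assms(1) c unfolding smooth_vf_def by blast
  then show "smooth_on (snd c ` (W \<inter> fst c)) ((\<lambda>q. components M c q (Y q)) \<circ> chart_inv c)"
    by (rule smooth_on_cong) (use assms c in auto)
qed

lemma smooth_fn_const: "open W \<Longrightarrow> smooth_fn M W (\<lambda>q. k)"
  unfolding smooth_fn_def o_def by (auto intro: smooth_on_const)

lemma smooth_fn_add:
  assumes "open W" "smooth_fn M W f" "smooth_fn M W g"
  shows "smooth_fn M W (\<lambda>q. f q + g q)"
  using assms smooth_on_add[OF open_chart_image_Int] unfolding smooth_fn_def o_def by blast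

lemma smooth_fn_bounded_linear:
  assumes "bounded_linear L" "open W" "smooth_fn M W f"
  shows "smooth_fn M W (\<lambda>q. L (f q))"
  using assms(2,3) smooth_on_bounded_linear[OF assms(1) open_chart_image_Int]
  unfolding smooth_fn_def o_def by blast

lemma smooth_fn_bounded_bilinear:
  assumes "bounded_bilinear B" "open W" "smooth_fn M W f" "smooth_fn M W g"
  shows "smooth_fn M W (\<lambda>q. B (f q) (g q))"
  using assms(2-4) smooth_on_bounded_bilinear[OF assms(1) open_chart_image_Int]
  unfolding smooth_fn_def o_def by blast

lemmas smooth_fn_mult = smooth_fn_bounded_bilinear[OF bounded_bilinear_mult]

lemma smooth_fn_inverse:
  fixes f :: "'m \<Rightarrow> real"
  assumes "open W" "smooth_fn M W f" "\<And>q. q \<in> W \<Longrightarrow> f q \<noteq> 0"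
  shows "smooth_fn M W (\<lambda>q. inverse (f q))"
  unfolding smooth_fn_def
proof
  fix c assume c: "c \<in> atlas M"
  have "smooth_on (snd c ` (W \<inter> fst c)) (\<lambda>x. inverse (f (chart_inv c x)))"
    using assms c by (intro smooth_on_inverse smooth_fnD) auto
  then show "smooth_on (snd c ` (W \<inter> fst c)) ((\<lambda>q. inverse (f q)) \<circ> chart_inv c)"
    by (simp add: o_def)
qed

lemma smooth_vf_add:
  assumes "open W" "smooth_vf M W X" "smooth_vf M W Y"
  shows "smooth_vf M W (\<lambda>q. X q + Y q)"
  unfolding smooth_vf_def
proof
  fix c assume c: "c \<in> atlas M"
  have "smooth_on (snd c ` (W \<inter> fst c))
      (\<lambda>x. components M c (chart_inv c x) (X (chart_inv c x)) +
           components M c (chart_inv c x) (Y (chart_inv c x)))"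
    using assms c by (intro smooth_on_add smooth_vfD) auto
  then show "smooth_on (snd c ` (W \<inter> fst c)) ((\<lambda>q. components M c q (X q + Y q)) \<circ> chart_inv c)"
    by (rule smooth_on_cong) (use assms c in \<open>auto simp: linear_add[OF linear_components]\<close>)
qed

lemma smooth_vf_scaleR:
  assumes "open W" "smooth_fn M W f" "smooth_vf M W X"
  shows "smooth_vf M W (\<lambda>q. f q *\<^sub>R X q)"
  unfolding smooth_vf_def
proof
  fix c assume c: "c \<in> atlas M"
  have "smooth_on (snd c ` (W \<inter> fst c))
      (\<lambda>x. f (chart_inv c x) *\<^sub>R components M c (chart_inv c x) (X (chart_inv c x)))"
    using assms c
    by (intro smooth_on_bounded_bilinear[OF bounded_bilinear_scaleR] smooth_fnD smooth_vfD) auto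
  then show "smooth_on (snd c ` (W \<inter> fst c)) ((\<lambda>q. components M c q (f q *\<^sub>R X q)) \<circ> chart_inv c)"
    by (rule smooth_on_cong) (use assms c in \<open>auto simp: linear_scale[OF linear_components]\<close>)
qed

lemma smooth_vf_zero:
  assumes "open W"
  shows "smooth_vf M W (\<lambda>q. 0)"
  unfolding smooth_vf_def
proof
  fix c assume c: "c \<in> atlas M"
  show "smooth_on (snd c ` (W \<inter> fst c)) ((\<lambda>q. components M c q 0) \<circ> chart_inv c)"
    by (rule smooth_on_cong[OF smooth_on_const[of _ 0]])
       (use assms c in \<open>auto simp: linear_0[OF linear_components]\<close>)
qed

lemma smooth_vf_sum:
  "\<lbrakk>open W; \<And>i. i \<in> I \<Longrightarrow> smooth_vf M W (X i)\<rbrakk> \<Longrightarrow> smooth_vf M W (\<lambda>q. \<Sum>i\<in>I. X i q)"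
  by (induction I rule: infinite_finite_induct) (auto intro: smooth_vf_zero smooth_vf_add)

lemma smooth_vf_diff:
  assumes "open W" "smooth_vf M W X" "smooth_vf M W Y"
  shows "smooth_vf M W (\<lambda>q. X q - Y q)"
  using smooth_vf_add[OF assms(1,2) smooth_vf_scaleR[OF assms(1) smooth_fn_const[OF assms(1), of "-1"] assms(3)]]
  by simp

text \<open>Smooth transition maps let a function on a chart domain be tested in that chart only.\<close>

lemma smooth_fn_in_chart:
  assumes c: "c \<in> atlas M" and W: "open W" "W \<subseteq> fst c"
    and f: "smooth_on (snd c ` W) (f \<circ> chart_inv c)"
  shows "smooth_fn M W f"
  unfolding smooth_fn_def
proof
  fix d assume d: "d \<in> atlas M"
  have "smooth_on (snd d ` (W \<inter> fst d)) ((f \<circ> chart_inv c) \<circ> (snd c \<circ> chart_inv d))"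
  proof (rule smooth_on_compose[OF _ _ _ f])
    show "smooth_on (snd d ` (W \<inter> fst d)) (snd c \<circ> chart_inv d)"
      by (rule smooth_on_subset[OF smooth_transition[OF d c]]) (use W in auto)
  qed (use c d W in \<open>auto intro: open_chart_image\<close>)
  then show "smooth_on (snd d ` (W \<inter> fst d)) (f \<circ> chart_inv d)"
    by (rule smooth_on_cong) (use c d W in auto)
qed

lemma smooth_vf_chart_frame:
  assumes c: "c \<in> atlas M"
  shows "smooth_vf M (fst c) (chart_frame M c v)"
  unfolding smooth_vf_def
proof
  fix d assume d: "d \<in> atlas M"
  let ?D = "\<lambda>x. frechet_derivative (snd d \<circ> chart_inv c) (at x) v"
  have "smooth_on (snd d ` (fst c \<inter> fst d)) (?D \<circ> (snd c \<circ> chart_inv d))"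
  proof (rule smooth_on_compose)
    show "smooth_on (snd c ` (fst c \<inter> fst d)) ?D"
      by (intro smooth_on_frechet_derivative smooth_transition c d)
    show "smooth_on (snd d ` (fst c \<inter> fst d)) (snd c \<circ> chart_inv d)"
      using smooth_transition[OF d c] by (simp add: Int_commute)
  qed (use c d in \<open>auto intro!: open_chart_image\<close>)
  then show "smooth_on (snd d ` (fst c \<inter> fst d)) ((\<lambda>q. components M d q (chart_frame M c v q)) \<circ> chart_inv d)"
    by (rule smooth_on_cong)
       (use c d in \<open>auto simp: components_chart_frame coord_change_def\<close>)
qed

lemma smooth_vf_extend: "smooth_vf M (fst (chart_at M p)) (extend M p v)"
  by (simp add: extend_eq_chart_frame smooth_vf_chart_frame)

lemma smooth_fn_components:
  assumes c: "c \<in> atlas M" and W: "open W" "W \<subseteq> fst c" and X: "smooth_vf M W X"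
  shows "smooth_fn M W (\<lambda>q. components M c q (X q))"
proof (rule smooth_fn_in_chart[OF c W])
  have "W \<inter> fst c = W" using W by blast
  then show "smooth_on (snd c ` W) ((\<lambda>q. components M c q (X q)) \<circ> chart_inv c)"
    using X c unfolding smooth_vf_def by metis
qed

lemma smooth_fn_component:
  "\<lbrakk>c \<in> atlas M; open W; W \<subseteq> fst c; smooth_vf M W X\<rbrakk> \<Longrightarrow>
     smooth_fn M W (\<lambda>q. components M c q (X q) \<bullet> b)"
  by (intro smooth_fn_bounded_linear[OF bounded_linear_inner_left] smooth_fn_components)

text \<open>With smooth coefficients, this reduces smoothness of tensorial expressions to that on coordinate
  fields.\<close>

lemma vf_frame_expansion:
  assumes "c \<in> atlas M" "q \<in> fst c"
  shows "v = (\<Sum>b\<in>Basis. (components M c q v \<bullet> b) *\<^sub>R chart_frame M c b q)"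
proof -
  have "v = chart_frame M c (\<Sum>b\<in>Basis. (components M c q v \<bullet> b) *\<^sub>R b) q"
    using assms by (simp add: euclidean_representation chart_frame_components)
  then show ?thesis
    by (simp add: linear_sum[OF linear_chart_frame[OF assms]] linear_scale[OF linear_chart_frame[OF assms]])
qed

text \<open>As smoothness is tested on the pieces \<open>W \<inter> fst c\<close> anyway, a different argument may be used on
  each chart domain.\<close>

lemma smooth_vf_locally:
  assumes "\<And>c. c \<in> atlas M \<Longrightarrow> smooth_vf M (W \<inter> fst c) X"
  shows "smooth_vf M W X"
  unfolding smooth_vf_def using assms unfolding smooth_vf_def by (metis Int_assoc Int_absorb)

section \<open>Directional derivatives\<close>

lemma smooth_fn_has_derivative:
  assumes "smooth_fn M W f" "open W" "p \<in> W"
  shows "(f \<circ> chart_inv (chart_at M p) has_derivative (\<lambda>v. dir_deriv M p v f))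
     (at (snd (chart_at M p) p))"
proof -
  have "f \<circ> chart_inv (chart_at M p) differentiable (at (snd (chart_at M p) p))"
    using assms unfolding smooth_fn_def by (intro smooth_on_imp_differentiable[of "snd (chart_at M p) ` (W \<inter> fst (chart_at M p))"]) auto
  then show ?thesis unfolding dir_deriv_def by (rule has_derivative_frechet)
qed

lemma dir_derivI:
  "(f \<circ> chart_inv (chart_at M p) has_derivative F) (at (snd (chart_at M p) p)) \<Longrightarrow> dir_deriv M p v f = F v"
  unfolding dir_deriv_def by (simp add: frechet_derivativeI)

lemma dir_deriv_cong:
  assumes "smooth_fn M W f" "open W" "p \<in> W" "\<And>q. q \<in> W \<Longrightarrow> f q = g q"
  shows "dir_deriv M p v g = dir_deriv M p v f"
proof (rule dir_derivI)
  let ?c = "chart_at M p"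
  show "(g \<circ> chart_inv ?c has_derivative (\<lambda>v. dir_deriv M p v f)) (at (snd ?c p))"
    by (rule has_derivative_transform_within_open[OF smooth_fn_has_derivative[OF assms(1-3)],
          where s = "snd ?c ` (W \<inter> fst ?c)"])
       (use assms in auto)
qed

lemma dir_deriv_const [simp]: "dir_deriv M p v (\<lambda>q. k) = 0"
  by (rule dir_derivI) (simp add: o_def)

lemma dir_deriv_add:
  assumes "smooth_fn M W f" "smooth_fn M W g" "open W" "p \<in> W"
  shows "dir_deriv M p v (\<lambda>q. f q + g q) = dir_deriv M p v f + dir_deriv M p v g"
  by (rule dir_derivI)
     (use has_derivative_add[OF smooth_fn_has_derivative[OF assms(1,3,4)] smooth_fn_has_derivative[OF assms(2,3,4)]]
       in \<open>simp add: o_def\<close>)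

lemma dir_deriv_diff:
  assumes "smooth_fn M W f" "smooth_fn M W g" "open W" "p \<in> W"
  shows "dir_deriv M p v (\<lambda>q. f q - g q) = dir_deriv M p v f - dir_deriv M p v g"
  by (rule dir_derivI)
     (use has_derivative_diff[OF smooth_fn_has_derivative[OF assms(1,3,4)] smooth_fn_has_derivative[OF assms(2,3,4)]]
       in \<open>simp add: o_def\<close>)

lemma dir_deriv_bounded_linear:
  assumes "bounded_linear L" "smooth_fn M W f" "open W" "p \<in> W"
  shows "dir_deriv M p v (\<lambda>q. L (f q)) = L (dir_deriv M p v f)"
  by (rule dir_derivI)
     (use bounded_linear.has_derivative[OF assms(1) smooth_fn_has_derivative[OF assms(2-4)]]
       in \<open>simp add: o_def\<close>)

lemma dir_deriv_mult:
  fixes f g :: "'m \<Rightarrow> real"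
  assumes "smooth_fn M W f" "smooth_fn M W g" "open W" "p \<in> W"
  shows "dir_deriv M p v (\<lambda>q. f q * g q) = f p * dir_deriv M p v g + dir_deriv M p v f * g p"
  by (rule dir_derivI)
     (use has_derivative_mult[OF smooth_fn_has_derivative[OF assms(1,3,4)] smooth_fn_has_derivative[OF assms(2,3,4)]]
       in \<open>simp add: o_def\<close>)

lemma dir_deriv_chart_frame:
  assumes c: "c \<in> atlas M" "q \<in> fst c" and f: "smooth_fn M W f" "open W" "q \<in> W"
  shows "dir_deriv M q (chart_frame M c v q) f = frechet_derivative (f \<circ> chart_inv c) (at (snd c q)) v"
  using frechet_derivativeI[OF chart_change_has_derivative[OF c(1) chart_at(1)[of q] c(2) chart_at(2)
      smooth_fn_has_derivative[OF f]]]
  by (simp add: chart_frame_def)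

lemma smooth_fn_dir_deriv_chart_frame:
  assumes c: "c \<in> atlas M" and f: "smooth_fn M W f" "open W" "W \<subseteq> fst c"
  shows "smooth_fn M W (\<lambda>q. dir_deriv M q (chart_frame M c v q) f)"
proof (rule smooth_fn_in_chart[OF c f(2,3)])
  have "smooth_on (snd c ` W) (f \<circ> chart_inv c)"
    using f c unfolding smooth_fn_def by (metis Int_absorb2)
  then have "smooth_on (snd c ` W) (\<lambda>x. frechet_derivative (f \<circ> chart_inv c) (at x) v)"
    by (rule smooth_on_frechet_derivative)
  then show "smooth_on (snd c ` W) ((\<lambda>q. dir_deriv M q (chart_frame M c v q) f) \<circ> chart_inv c)"
  proof (rule smooth_on_cong)
    fix x assume "x \<in> snd c ` W"
    then obtain q where q: "q \<in> W" "x = snd c q" by blast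
    then have "q \<in> fst c" using f by blast
    then show "frechet_derivative (f \<circ> chart_inv c) (at x) v =
        ((\<lambda>q. dir_deriv M q (chart_frame M c v q) f) \<circ> chart_inv c) x"
      using q c dir_deriv_chart_frame[OF c _ f(1,2), of q v] by simp
  qed (use c f in \<open>auto intro: open_chart_image\<close>)
qed

text \<open>Coordinate fields commute. The preferred chart at \<open>q\<close> need not be \<open>c\<close>, so this is the
  symmetry of the second derivatives of the transition map.\<close>

lemma lie_bracket_chart_frame:
  assumes c: "c \<in> atlas M" "q \<in> fst c"
  shows "lie_bracket M (chart_frame M c u) (chart_frame M c v) q = 0"
proof -
  let ?d = "chart_at M q"
  let ?g = "snd ?d \<circ> chart_inv c"
  let ?W = "fst c \<inter> fst ?d"
  have "dir_deriv M q (chart_frame M c u q) (\<lambda>r. components M ?d r (chart_frame M c v r)) =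
     frechet_derivative (\<lambda>x. frechet_derivative ?g (at x) v) (at (snd c q)) u" for u v
  proof -
    have sm: "smooth_fn M ?W (\<lambda>r. components M ?d r (chart_frame M c v r))"
      using c by (intro smooth_fn_components smooth_vf_subset[OF smooth_vf_chart_frame]) auto
    have "(\<lambda>x. frechet_derivative ?g (at x) v) differentiable at (snd c q)"
      using c by (intro smooth_on_imp_differentiable[OF smooth_on_frechet_derivative[OF smooth_transition]]) auto
    then have "((\<lambda>r. components M ?d r (chart_frame M c v r)) \<circ> chart_inv c has_derivative
        frechet_derivative (\<lambda>x. frechet_derivative ?g (at x) v) (at (snd c q))) (at (snd c q))"
      by (rule has_derivative_transform_within_open[OF has_derivative_frechet, where s = "snd c ` ?W"])
         (use c in \<open>auto intro!: open_chart_image simp: components_chart_frame coord_change_def\<close>)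
    then show ?thesis
      using dir_deriv_chart_frame[OF c sm, of u] c by (simp add: frechet_derivativeI open_Int)
  qed
  then show ?thesis
    using symmetric_second_derivative[OF _ _ smooth_transition[OF c(1) chart_at(1)[of q]], of "snd c q" u v]
      c open_chart_image[OF c(1), of ?W]
    unfolding lie_bracket_def by (simp add: open_Int)
qed

section \<open>Affine connections and torsion\<close>

lemma
  assumes "affine_connection M D" "open W" "smooth_vf M W Y"
  shows connection_linear: "p \<in> W \<Longrightarrow> linear (\<lambda>v. D p v Y)"
    and connection_add: "\<lbrakk>smooth_vf M W Z; p \<in> W\<rbrakk> \<Longrightarrow> D p v (\<lambda>q. Y q + Z q) = D p v Y + D p v Z"
    and connection_scaleR: "\<lbrakk>smooth_fn M W f; p \<in> W\<rbrakk> \<Longrightarrow>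
      D p v (\<lambda>q. f q *\<^sub>R Y q) = dir_deriv M p v f *\<^sub>R Y p + f p *\<^sub>R D p v Y"
    and connection_cong: "\<lbrakk>p \<in> W; \<And>q. q \<in> W \<Longrightarrow> Y q = Z q\<rbrakk> \<Longrightarrow> D p v Y = D p v Z"
    and smooth_vf_connection: "smooth_vf M W X \<Longrightarrow> smooth_vf M W (\<lambda>p. D p (X p) Y)"
proof -
  note conn = assms(1)[unfolded affine_connection_def, THEN spec, THEN spec, THEN mp, OF conjI[OF assms(2,3)]]
  show "p \<in> W \<Longrightarrow> linear (\<lambda>v. D p v Y)"
    by (rule conn[THEN conjunct1, THEN bspec])
  show "\<lbrakk>smooth_vf M W Z; p \<in> W\<rbrakk> \<Longrightarrow> D p v (\<lambda>q. Y q + Z q) = D p v Y + D p v Z"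
    by (rule conn[THEN conjunct2, THEN conjunct1, THEN spec, THEN mp, THEN bspec, THEN spec])
  show "\<lbrakk>smooth_fn M W f; p \<in> W\<rbrakk> \<Longrightarrow>
      D p v (\<lambda>q. f q *\<^sub>R Y q) = dir_deriv M p v f *\<^sub>R Y p + f p *\<^sub>R D p v Y"
    by (rule conn[THEN conjunct2, THEN conjunct2, THEN conjunct1, THEN spec, THEN mp, THEN bspec, THEN spec])
  show "D p v Y = D p v Z" if "p \<in> W" "\<And>q. q \<in> W \<Longrightarrow> Y q = Z q"
    using conn[THEN conjunct2, THEN conjunct2, THEN conjunct2, THEN conjunct1, THEN spec, of Z]
      smooth_vf_cong[OF assms(3,2), of Z] that by simp
  show "smooth_vf M W X \<Longrightarrow> smooth_vf M W (\<lambda>p. D p (X p) Y)"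
    by (rule conn[THEN conjunct2, THEN conjunct2, THEN conjunct2, THEN conjunct2, THEN spec, THEN mp])
qed

lemma connection_sum:
  assumes D: "affine_connection M D" and W: "open W" "p \<in> W"
  shows "(\<And>i. i \<in> I \<Longrightarrow> smooth_vf M W (Y i)) \<Longrightarrow> D p v (\<lambda>q. \<Sum>i\<in>I. Y i q) = (\<Sum>i\<in>I. D p v (Y i))"
proof (induction I rule: infinite_finite_induct)
  case (insert i I)
  then show ?case
    using connection_add[OF D W(1) _ smooth_vf_sum[OF W(1)] W(2), of "Y i" I Y v] by simp
qed (use connection_scaleR[OF D W(1) smooth_vf_zero[OF W(1)] smooth_fn_const[OF W(1), of 0] W(2), of v] in auto)

text \<open>Expand \<open>Y\<close> in the coordinate frame of the preferred chart at \<open>p\<close> and apply the Leibniz rule; the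
  vectors \<open>D p v (extend M p b)\<close> are the Christoffel symbols.\<close>

lemma connection_in_coordinates:
  assumes D: "affine_connection M D" and W: "open W" "p \<in> W" and Y: "smooth_vf M W Y"
  shows "D p v Y = dir_deriv M p v (\<lambda>q. components M (chart_at M p) q (Y q))
                   + (\<Sum>b\<in>Basis. (Y p \<bullet> b) *\<^sub>R D p v (extend M p b))"
proof -
  let ?c = "chart_at M p"
  define V where "V = W \<inter> fst ?c"
  have V: "open V" "p \<in> V" "V \<subseteq> fst ?c" "V \<subseteq> W" using W by (auto simp: V_def)
  have YV: "smooth_vf M V Y" using Y V smooth_vf_subset by blast
  define y where "y b q = components M ?c q (Y q) \<bullet> b" for b q
  have y: "smooth_fn M V (y b)" for b
    unfolding y_def using V YV by (intro smooth_fn_component) auto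
  have G: "smooth_vf M V (extend M p b)" for b
    using smooth_vf_extend V smooth_vf_subset by blast
  have "D p v Y = D p v (\<lambda>q. \<Sum>b\<in>Basis. y b q *\<^sub>R extend M p b q)"
  proof (rule connection_cong[OF D V(1) YV V(2)])
    show "Y q = (\<Sum>b\<in>Basis. y b q *\<^sub>R extend M p b q)" if "q \<in> V" for q
      unfolding y_def extend_eq_chart_frame by (rule vf_frame_expansion) (use V that in auto)
  qed
  also have "\<dots> = (\<Sum>b\<in>Basis. D p v (\<lambda>q. y b q *\<^sub>R extend M p b q))"
    by (intro connection_sum[OF D V(1,2)] smooth_vf_scaleR V y G)
  also have "\<dots> = (\<Sum>b\<in>Basis. dir_deriv M p v (y b) *\<^sub>R b) + (\<Sum>b\<in>Basis. y b p *\<^sub>R D p v (extend M p b))"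
    by (simp add: connection_scaleR[OF D V(1) G y V(2)] sum.distrib)
  also have "(\<Sum>b\<in>Basis. dir_deriv M p v (y b) *\<^sub>R b) = dir_deriv M p v (\<lambda>q. components M ?c q (Y q))"
  proof -
    have "dir_deriv M p v (y b) = dir_deriv M p v (\<lambda>q. components M ?c q (Y q)) \<bullet> b" for b
      unfolding y_def
      by (rule dir_deriv_bounded_linear[OF bounded_linear_inner_left smooth_fn_components[OF _ V(1,3) YV] V(1,2)]) simp
    then show ?thesis by (simp add: euclidean_representation)
  qed
  finally show ?thesis by (simp add: y_def)
qed

lemma connection_extend:
  assumes D: "affine_connection M D"
  shows "D p v (extend M p w) = (\<Sum>b\<in>Basis. (w \<bullet> b) *\<^sub>R D p v (extend M p b))"
proof -
  let ?U = "fst (chart_at M p)"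
  have "dir_deriv M p v (\<lambda>q. components M (chart_at M p) q (extend M p w q)) = dir_deriv M p v (\<lambda>q. w)"
    by (rule dir_deriv_cong[OF smooth_fn_const, of ?U])
       (auto simp: extend_eq_chart_frame components_chart_frame)
  then show ?thesis
    using connection_in_coordinates[OF D _ _ smooth_vf_extend[of p w], of p v] by simp
qed

lemma connection_eq_coordinate_derivative:
  assumes "affine_connection M D" "open W" "p \<in> W" "smooth_vf M W Y"
  shows "D p v Y = dir_deriv M p v (\<lambda>q. components M (chart_at M p) q (Y q)) + D p v (extend M p (Y p))"
  using connection_in_coordinates[OF assms] connection_extend[OF assms(1), of p v "Y p"] by simp

lemma bilinear_connection_extend:
  assumes D: "affine_connection M D"
  shows "bilinear (\<lambda>v w. D p v (extend M p w))"
  unfolding bilinear_def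
proof (intro conjI allI)
  show "linear (\<lambda>v. D p v (extend M p w))" for w
    by (rule connection_linear[OF D _ smooth_vf_extend]) auto
  show "linear (\<lambda>w. D p v (extend M p w))" for v
    by (subst connection_extend[OF D], intro linearI)
       (simp_all add: inner_add_left scaleR_add_left sum.distrib scaleR_sum_right)
qed

lemma torsion_eq: "torsion M D p u v = D p u (extend M p v) - D p v (extend M p u)"
  by (simp add: torsion_def extend_eq_chart_frame lie_bracket_chart_frame)

lemma bilinear_torsion:
  assumes "affine_connection M D"
  shows "bilinear (torsion M D p)"
  using bilinear_connection_extend[OF assms, of p]
  unfolding bilinear_def torsion_eq[abs_def] by (auto intro: linear_compose_sub)

lemma torsion_skew: "torsion M D p u v = - torsion M D p v u"
  by (simp add: torsion_eq)

text \<open>The Christoffel terms on the right are those of \<open>torsion_eq\<close>, and the coordinate derivatives of \<open>X\<close>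
  and \<open>Y\<close> are cancelled by the bracket.\<close>

lemma torsion_fields:
  assumes D: "affine_connection M D" and W: "open W" "p \<in> W" and XY: "smooth_vf M W X" "smooth_vf M W Y"
  shows "torsion M D p (X p) (Y p) = D p (X p) Y - D p (Y p) X - lie_bracket M X Y p"
  using connection_eq_coordinate_derivative[OF D W XY(1)] connection_eq_coordinate_derivative[OF D W XY(2)]
  by (simp add: torsion_eq lie_bracket_def)

lemma smooth_vf_torsion:
  assumes D: "affine_connection M D" and W: "open W" and X: "smooth_vf M W X" and Y: "smooth_vf M W Y"
  shows "smooth_vf M W (\<lambda>q. torsion M D q (X q) (Y q))"
proof (rule smooth_vf_locally)
  fix c assume c: "c \<in> atlas M"
  define V where "V = W \<inter> fst c"
  have V: "open V" "V \<subseteq> fst c" "V \<subseteq> W" using W c by (auto simp: V_def)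
  have F: "smooth_vf M V (chart_frame M c b)" for b
    using smooth_vf_subset[OF smooth_vf_chart_frame[OF c]] V by blast
  have co: "smooth_fn M V (\<lambda>q. components M c q (X q) \<bullet> b)" "smooth_fn M V (\<lambda>q. components M c q (Y q) \<bullet> b)" for b
    using smooth_fn_component[OF c V(1,2) smooth_vf_subset[OF X V(3)]]
      smooth_fn_component[OF c V(1,2) smooth_vf_subset[OF Y V(3)]] by blast+
  have frame: "smooth_vf M V (\<lambda>q. torsion M D q (chart_frame M c a q) (chart_frame M c b q))" for a b
  proof (rule smooth_vf_cong)
    show "smooth_vf M V (\<lambda>q. D q (chart_frame M c a q) (chart_frame M c b) -
            D q (chart_frame M c b q) (chart_frame M c a))"
      using V by (intro smooth_vf_diff smooth_vf_connection[OF D] F)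
    show "D q (chart_frame M c a q) (chart_frame M c b) - D q (chart_frame M c b q) (chart_frame M c a) =
        torsion M D q (chart_frame M c a q) (chart_frame M c b q)" if "q \<in> V" for q
      using torsion_fields[OF D V(1) that F F] lie_bracket_chart_frame[OF c] V(2) that by auto
  qed (rule V)
  have "smooth_vf M V (\<lambda>q. \<Sum>a\<in>Basis. \<Sum>b\<in>Basis. (components M c q (X q) \<bullet> a) *\<^sub>R
      (components M c q (Y q) \<bullet> b) *\<^sub>R torsion M D q (chart_frame M c a q) (chart_frame M c b q))"
    by (intro smooth_vf_sum smooth_vf_scaleR co frame V)
  then have "smooth_vf M V (\<lambda>q. torsion M D q (X q) (Y q))"
  proof (rule smooth_vf_cong[OF _ V(1)])
    fix q assume "q \<in> V"
    then have q: "q \<in> fst c" using V by blast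
    note bil = bilinear_torsion[OF D, of q]
    have l: "linear (\<lambda>u. torsion M D q u v)" "linear (torsion M D q u)" for u v
      using bil by (auto simp: bilinear_def)
    have "torsion M D q (X q) (Y q) = torsion M D q
        (\<Sum>a\<in>Basis. (components M c q (X q) \<bullet> a) *\<^sub>R chart_frame M c a q)
        (\<Sum>b\<in>Basis. (components M c q (Y q) \<bullet> b) *\<^sub>R chart_frame M c b q)"
      by (rule arg_cong2[where f = "torsion M D q"]) (rule vf_frame_expansion[OF c q])+
    also have "\<dots> = (\<Sum>a\<in>Basis. \<Sum>b\<in>Basis. (components M c q (X q) \<bullet> a) *\<^sub>R
        (components M c q (Y q) \<bullet> b) *\<^sub>R torsion M D q (chart_frame M c a q) (chart_frame M c b q))"
      by (simp only: linear_sum[OF l(1)] linear_scale[OF l(1)])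
         (simp only: linear_sum[OF l(2)] linear_scale[OF l(2)] scaleR_sum_right)
    finally show "(\<Sum>a\<in>Basis. \<Sum>b\<in>Basis. (components M c q (X q) \<bullet> a) *\<^sub>R
        (components M c q (Y q) \<bullet> b) *\<^sub>R torsion M D q (chart_frame M c a q) (chart_frame M c b q)) =
        torsion M D q (X q) (Y q)" by (rule sym)
  qed
  then show "smooth_vf M (W \<inter> fst c) (\<lambda>q. torsion M D q (X q) (Y q))" by (simp add: V_def)
qed

section \<open>Contact forms\<close>

text \<open>For parallel \<open>\<theta>\<close>, \<open>\<theta>(D\<^sub>X Y) = X(\<theta>(Y))\<close>, which turns the definition of the torsion into the Cartan
  formula.\<close>

lemma form_torsion_eq_ext_deriv:
  assumes D: "affine_connection M D" and \<theta>: "one_form_on M UNIV \<theta>" and par: "parallel_one_form M D \<theta>"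
  shows "\<theta> p (torsion M D p u v) = ext_deriv M \<theta> p u v"
proof -
  have "linear (\<theta> p)" using \<theta> unfolding one_form_on_def by blast
  moreover have "dir_deriv M p a (\<lambda>q. \<theta> q (extend M p b q)) = \<theta> p (D p a (extend M p b))" for a b
    using par smooth_vf_extend[of p b] open_domain chart_at unfolding parallel_one_form_def
    by (metis eq_iff_diff_eq_0)
  ultimately show ?thesis
    by (simp add: ext_deriv_def torsion_def Let_def linear_diff)
qed

lemma bilinear_ext_deriv:
  assumes "affine_connection M D" "one_form_on M UNIV \<theta>" "parallel_one_form M D \<theta>"
  shows "bilinear (ext_deriv M \<theta> p)"
proof -
  have "linear (\<theta> p)" using assms(2) unfolding one_form_on_def by blast
  then have "bilinear (\<lambda>u v. \<theta> p (torsion M D p u v))"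
    using bilinear_torsion[OF assms(1), of p] linear_compose[of _ "\<theta> p"]
    unfolding bilinear_def o_def by blast
  then show ?thesis by (simp add: form_torsion_eq_ext_deriv[OF assms])
qed

lemma smooth_fn_one_form:
  "\<lbrakk>one_form_on M UNIV \<theta>; open W; smooth_vf M W X\<rbrakk> \<Longrightarrow> smooth_fn M W (\<lambda>q. \<theta> q (X q))"
  unfolding one_form_on_def by blast

lemma ext_deriv_rescale:
  assumes \<theta>: "one_form_on M UNIV \<theta>" and \<sigma>: "smooth_fn M UNIV \<sigma>"
    and \<theta>': "\<And>p v. \<theta>' p v = \<sigma> p * \<theta> p v"
  shows "ext_deriv M \<theta>' p u v =
    \<sigma> p * ext_deriv M \<theta> p u v + dir_deriv M p u \<sigma> * \<theta> p v - dir_deriv M p v \<sigma> * \<theta> p u"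
proof -
  let ?U = "fst (chart_at M p)"
  have "dir_deriv M p a (\<lambda>q. \<theta>' q (extend M p b q)) =
      \<sigma> p * dir_deriv M p a (\<lambda>q. \<theta> q (extend M p b q)) + dir_deriv M p a \<sigma> * \<theta> p b" for a b
    unfolding \<theta>'
    using dir_deriv_mult[OF smooth_fn_subset[OF \<sigma>] smooth_fn_one_form[OF \<theta> _ smooth_vf_extend], of p p a b]
    by simp
  then show ?thesis by (simp add: ext_deriv_def Let_def \<theta>' algebra_simps)
qed

text \<open>Both are hyperplanes.\<close>

lemma contact_distribution_eq_kernel:
  assumes "contact_structure M H" "annihilating_form M H UNIV \<theta>"
  shows "H p = {v. \<theta> p v = 0}"
proof -
  have lin: "linear (\<theta> p)" and nz: "\<exists>v. \<theta> p v \<noteq> 0" and sub: "H p \<subseteq> {v. \<theta> p v = 0}"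
    using assms(2) unfolding annihilating_form_def one_form_on_def by auto
  have H: "subspace (H p)" "dim (H p) + 1 = DIM('e)"
    using assms(1) unfolding contact_structure_def by blast+
  have K: "subspace {v. \<theta> p v = 0}" using lin by (rule linear_subspace_kernel)
  have "span {v. \<theta> p v = 0} \<noteq> UNIV" using nz K by (auto simp: span_eq_iff[THEN iffD2])
  then have "dim {v. \<theta> p v = 0} < DIM('e)" using dim_eq_full[of "{v. \<theta> p v = 0}"] dim_subset_UNIV[of "{v. \<theta> p v = 0}"]
    by linarith
  then show ?thesis using subspace_dim_equal[OF H(1) K sub] H(2) by linarith
qed

text \<open>Differentiating \<open>d(\<sigma>\<theta>) = \<sigma> d\<theta> + d\<sigma> \<and> \<theta>\<close> on constant extensions of contact vectors. These
  extensions need not stay in \<open>H\<close>, but the resulting terms in \<open>d\<sigma> \<and> \<theta>\<close> are the same for both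
  connections, because \<open>\<theta> p (\<Lambda> p v u) = 0\<close> for contact vectors \<open>u\<close>.\<close>

lemma rescaled_parallel_two_form:
  assumes D: "affine_connection M D" "parallel_one_form M D \<theta>" "parallel_two_form M D (ext_deriv M \<theta>)"
    and D': "affine_connection M D'" "parallel_one_form M D' \<theta>'" "parallel_two_form M D' (ext_deriv M \<theta>')"
    and \<theta>: "one_form_on M UNIV \<theta>" and \<sigma>: "smooth_fn M UNIV \<sigma>" "\<And>q. \<sigma> q \<noteq> 0"
    and \<theta>': "\<And>p v. \<theta>' p v = \<sigma> p * \<theta> p v"
  defines "\<Lambda> \<equiv> \<lambda>p v u. D' p v (extend M p u) - D p v (extend M p u)"
  shows "\<theta> p u = 0 \<Longrightarrow> \<theta> p (\<Lambda> p v u) = 0"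
    and "\<lbrakk>\<theta> p u = 0; \<theta> p w = 0\<rbrakk> \<Longrightarrow>
      dir_deriv M p v \<sigma> * ext_deriv M \<theta> p u w =
      \<sigma> p * (ext_deriv M \<theta> p (\<Lambda> p v u) w + ext_deriv M \<theta> p u (\<Lambda> p v w))"
proof -
  let ?c = "chart_at M p"
  let ?U = "fst ?c"
  let ?E = "extend M p"
  have U: "open ?U" "p \<in> ?U" by auto
  have \<sigma>U: "smooth_fn M ?U \<sigma>" by (rule smooth_fn_subset[OF \<sigma>(1)]) simp
  have lin\<theta>: "linear (\<theta> q)" for q using \<theta> unfolding one_form_on_def by blast
  have \<theta>E: "smooth_fn M ?U (\<lambda>q. \<theta> q (?E a q))" for a
    by (rule smooth_fn_one_form[OF \<theta> U(1) smooth_vf_extend])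
  have d\<theta>: "dir_deriv M p v (\<lambda>q. \<theta> q (?E a q)) = \<theta> p (D p v (?E a))" for v a
    using D(2) smooth_vf_extend[of p a] U unfolding parallel_one_form_def
    by (metis eq_iff_diff_eq_0)
  have \<theta>\<Lambda>: "\<theta> p (\<Lambda> p v u) = 0" if "\<theta> p u = 0" for u v
  proof -
    have "dir_deriv M p v (\<lambda>q. \<theta>' q (?E u q)) = \<theta>' p (D' p v (?E u))"
      using D'(2) smooth_vf_extend[of p u] U unfolding parallel_one_form_def
      by (metis eq_iff_diff_eq_0)
    then have "\<sigma> p * \<theta> p (D p v (?E u)) = \<sigma> p * \<theta> p (D' p v (?E u))"
      using dir_deriv_mult[OF \<sigma>U \<theta>E U, of v u] that by (simp add: \<theta>' d\<theta>)
    then show ?thesis using \<sigma>(2) by (simp add: \<Lambda>_def linear_diff[OF lin\<theta>])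
  qed
  show "\<theta> p u = 0 \<Longrightarrow> \<theta> p (\<Lambda> p v u) = 0" by (rule \<theta>\<Lambda>)
  assume uw: "\<theta> p u = 0" "\<theta> p w = 0"
  let ?\<omega> = "ext_deriv M \<theta>"
  note bil = bilinear_ext_deriv[OF D(1) \<theta> D(2), of p]
  note bil\<omega> = bilinear_lsub[OF bil] bilinear_rsub[OF bil]
  have \<omega>E: "smooth_fn M ?U (\<lambda>q. ?\<omega> q (?E u q) (?E w q))"
    using smooth_fn_one_form[OF \<theta> U(1) smooth_vf_torsion[OF D(1) U(1) smooth_vf_extend smooth_vf_extend]]
    by (simp add: form_torsion_eq_ext_deriv[OF D(1) \<theta> D(2)])
  define s where "s a q = dir_deriv M q (?E a q) \<sigma>" for a q
  have sE: "smooth_fn M ?U (s a)" for a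
    unfolding s_def extend_eq_chart_frame by (rule smooth_fn_dir_deriv_chart_frame[OF _ \<sigma>U]) auto
  have "dir_deriv M p v (\<lambda>q. ext_deriv M \<theta>' q (?E u q) (?E w q)) =
     dir_deriv M p v (\<lambda>q. (\<sigma> q * ?\<omega> q (?E u q) (?E w q) + s u q * \<theta> q (?E w q)) - s w q * \<theta> q (?E u q))"
    by (simp add: ext_deriv_rescale[OF \<theta> \<sigma>(1) \<theta>'] s_def)
  also have "\<dots> = \<sigma> p * dir_deriv M p v (\<lambda>q. ?\<omega> q (?E u q) (?E w q)) + dir_deriv M p v \<sigma> * ?\<omega> p u w
      + s u p * \<theta> p (D p v (?E w)) - s w p * \<theta> p (D p v (?E u))"
    by (simp add: dir_deriv_diff[OF smooth_fn_add[OF U(1) smooth_fn_mult[OF U(1) \<sigma>U \<omega>E]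
            smooth_fn_mult[OF U(1) sE \<theta>E]] smooth_fn_mult[OF U(1) sE \<theta>E] U]
          dir_deriv_add[OF smooth_fn_mult[OF U(1) \<sigma>U \<omega>E] smooth_fn_mult[OF U(1) sE \<theta>E] U]
          dir_deriv_mult[OF \<sigma>U \<omega>E U] dir_deriv_mult[OF sE \<theta>E U] d\<theta> uw)
  finally have "dir_deriv M p v (\<lambda>q. ext_deriv M \<theta>' q (?E u q) (?E w q)) = \<dots>" .
  moreover have "dir_deriv M p v (\<lambda>q. ?\<omega> q (?E u q) (?E w q)) =
      ?\<omega> p (D p v (?E u)) w + ?\<omega> p u (D p v (?E w))"
    using D(3) smooth_vf_extend[of p u] smooth_vf_extend[of p w] U unfolding parallel_two_form_def
    by (fastforce simp: algebra_simps)
  moreover have "dir_deriv M p v (\<lambda>q. ext_deriv M \<theta>' q (?E u q) (?E w q)) =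
      ext_deriv M \<theta>' p (D' p v (?E u)) w + ext_deriv M \<theta>' p u (D' p v (?E w))"
    using D'(3) smooth_vf_extend[of p u] smooth_vf_extend[of p w] U unfolding parallel_two_form_def
    by (fastforce simp: algebra_simps)
  moreover have "\<theta> p (D' p v (?E u)) = \<theta> p (D p v (?E u))" "\<theta> p (D' p v (?E w)) = \<theta> p (D p v (?E w))"
    using \<theta>\<Lambda>[OF uw(1), of v] \<theta>\<Lambda>[OF uw(2), of v] by (simp_all add: \<Lambda>_def linear_diff[OF lin\<theta>])
  ultimately show "dir_deriv M p v \<sigma> * ?\<omega> p u w = \<sigma> p * (?\<omega> p (\<Lambda> p v u) w + ?\<omega> p u (\<Lambda> p v w))"
    by (simp add: \<Lambda>_def bil\<omega> ext_deriv_rescale[OF \<theta> \<sigma>(1) \<theta>'] uw s_def algebra_simps)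
qed

section \<open>Unparameterized geodesics\<close>

lemma immersed_curve_in_chart:
  assumes "immersed_curve M (I, \<gamma>)" and c: "c \<in> atlas M"
  shows "open {t\<in>I. \<gamma> t \<in> fst c}" and "smooth_on {t\<in>I. \<gamma> t \<in> fst c} (snd c \<circ> \<gamma>)"
proof -
  have I: "open I" "continuous_on I \<gamma>" using assms unfolding immersed_curve_def by auto
  have "open (\<gamma> -` fst c \<inter> I)"
    using continuous_on_open_vimage[OF I(1), of \<gamma>] I(2) open_domain[OF c] by blast
  then show "open {t\<in>I. \<gamma> t \<in> fst c}" by (simp add: vimage_def Int_def conj_commute)
  show "smooth_on {t\<in>I. \<gamma> t \<in> fst c} (snd c \<circ> \<gamma>)"
    using assms unfolding immersed_curve_def by auto
qed

lemma components_velocity: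
  assumes \<gamma>: "immersed_curve M (I, \<gamma>)" and c: "c \<in> atlas M" and t: "t \<in> I" "\<gamma> t \<in> fst c"
  shows "components M c (\<gamma> t) (velocity M \<gamma> t) = vector_derivative (snd c \<circ> \<gamma>) (at t)"
proof -
  let ?d = "chart_at M (\<gamma> t)"
  let ?I = "{t\<in>I. \<gamma> t \<in> fst ?d}"
  have "(snd ?d \<circ> \<gamma> has_vector_derivative velocity M \<gamma> t) (at t)"
    unfolding velocity_def
    by (rule smooth_on_has_vector_derivative[OF immersed_curve_in_chart(2)[OF \<gamma>]]) (use t in auto)
  then have "((snd c \<circ> chart_inv ?d) \<circ> (snd ?d \<circ> \<gamma>) has_derivative
      coord_change ?d c (\<gamma> t) \<circ> (\<lambda>x. x *\<^sub>R velocity M \<gamma> t)) (at t)"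
    unfolding has_vector_derivative_def
    by (rule diff_chain_at) (use transition_has_derivative[of ?d c "\<gamma> t"] c t in simp)
  then have "((snd c \<circ> chart_inv ?d) \<circ> (snd ?d \<circ> \<gamma>) has_vector_derivative
      components M c (\<gamma> t) (velocity M \<gamma> t)) (at t)"
    unfolding has_vector_derivative_def components_def o_def
    using linear_scale[OF linear_coord_change[of ?d c "\<gamma> t"]] c t by simp
  then have "(snd c \<circ> \<gamma> has_vector_derivative components M c (\<gamma> t) (velocity M \<gamma> t)) (at t)"
    by (rule has_vector_derivative_transform_within_open[OF _ immersed_curve_in_chart(1)[OF \<gamma>, of ?d]])
       (use t in auto)
  then show ?thesis by (simp add: vector_derivative_at)
qed

text \<open>A reparameterization by \<open>h\<close> multiplies the sum below by \<open>(h')\<^sup>2\<close> and adds \<open>h''\<close> times the old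
  velocity; for a geodesic parameterization the sum vanishes.\<close>

lemma unparameterized_geodesic_acceleration:
  assumes D: "affine_connection M D" and geo: "unparameterized_geodesic M D (I, \<gamma>)" and t: "t \<in> I"
  defines "c \<equiv> chart_at M (\<gamma> t)" and "v \<equiv> velocity M \<gamma> t"
  shows "vector_derivative (\<lambda>s. vector_derivative (snd c \<circ> \<gamma>) (at s)) (at t) + D (\<gamma> t) v (extend M (\<gamma> t) v)
     \<in> span {v}"
proof -
  obtain J \<sigma> where same: "same_path (I, \<gamma>) (J, \<sigma>)" and "geodesic M D (J, \<sigma>)"
    using geo unfolding unparameterized_geodesic_def by auto
  then have \<sigma>: "immersed_curve M (J, \<sigma>)"
    and geod: "\<And>s. s \<in> J \<Longrightarrow> covariant_derivative_along M D \<sigma> (velocity M \<sigma>) s = 0"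
    unfolding geodesic_def by auto
  obtain h :: "real \<Rightarrow> real" where h: "bij_betw h I J" "smooth_on I h" "\<And>s. s \<in> I \<Longrightarrow> deriv h s \<noteq> 0"
    "\<And>s. s \<in> I \<Longrightarrow> \<gamma> s = \<sigma> (h s)"
    using same unfolding same_path_def by auto
  have hJ: "h s \<in> J" if "s \<in> I" for s using h(1) that by (auto simp: bij_betw_def)
  have \<gamma>: "immersed_curve M (I, \<gamma>)" using geo unfolding unparameterized_geodesic_def by blast
  have c: "c \<in> atlas M" "\<gamma> t \<in> fst c" by (simp_all add: c_def)
  let ?I = "{t\<in>I. \<gamma> t \<in> fst c}" and ?J = "{s\<in>J. \<sigma> s \<in> fst c}"
  let ?b' = "\<lambda>s. vector_derivative (snd c \<circ> \<sigma>) (at s)"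
  let ?h' = "\<lambda>s. vector_derivative h (at s)"
  have tI: "t \<in> ?I" and tJ: "h t \<in> ?J" using t c h(4) hJ by auto
  have "smooth_on ?I h" using h(2) by (rule smooth_on_subset) auto
  note rep = second_derivative_reparameterization[OF immersed_curve_in_chart(1)[OF \<gamma> c(1)] tI
      immersed_curve_in_chart(1)[OF \<sigma> c(1)] this immersed_curve_in_chart(2)[OF \<sigma> c(1)], of "snd c \<circ> \<gamma>"]
  have a': "vector_derivative (snd c \<circ> \<gamma>) (at t) = ?h' t *\<^sub>R ?b' (h t)"
    by (rule rep(1)) (use h(4) hJ in auto)
  have a'': "vector_derivative (\<lambda>s. vector_derivative (snd c \<circ> \<gamma>) (at s)) (at t) =
      (?h' t)\<^sup>2 *\<^sub>R vector_derivative ?b' (at (h t)) + vector_derivative ?h' (at t) *\<^sub>R ?b' (h t)"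
    by (rule rep(2)) (use h(4) hJ in auto)
  define w where "w = velocity M \<sigma> (h t)"
  have w: "?b' (h t) = w" unfolding w_def velocity_def c_def h(4)[OF t] ..
  have v: "v = ?h' t *\<^sub>R w" using a' w by (simp add: v_def velocity_def c_def)
  have h'0: "?h' t \<noteq> 0"
  proof -
    have "(h has_vector_derivative ?h' t) (at t)"
      by (rule smooth_on_has_vector_derivative[OF h(2) t])
    then have "deriv h t = ?h' t"
      by (simp add: DERIV_imp_deriv has_real_derivative_iff_has_vector_derivative)
    then show ?thesis using h(3)[OF t] by simp
  qed
  have cov: "vector_derivative ?b' (at (h t)) + D (\<gamma> t) w (extend M (\<gamma> t) w) = 0"
  proof -
    have "(?b' has_vector_derivative vector_derivative ?b' (at (h t))) (at (h t))"
      by (rule smooth_on_has_vector_derivative[OF smooth_on_vector_derivative[OF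
            immersed_curve_in_chart[OF \<sigma> c(1)]] tJ])
    then have "((\<lambda>s. components M c (\<sigma> s) (velocity M \<sigma> s)) has_vector_derivative
        vector_derivative ?b' (at (h t))) (at (h t))"
      by (rule has_vector_derivative_transform_within_open[OF _ immersed_curve_in_chart(1)[OF \<sigma> c(1)] tJ])
         (use components_velocity[OF \<sigma> c(1)] in auto)
    then show ?thesis
      using geod[OF hJ[OF t]] vector_derivative_at h(4)[OF t]
      unfolding covariant_derivative_along_def c_def w_def by metis
  qed
  note bil = bilinear_connection_extend[OF D, of "\<gamma> t"]
  have "D (\<gamma> t) v (extend M (\<gamma> t) v) = (?h' t)\<^sup>2 *\<^sub>R D (\<gamma> t) w (extend M (\<gamma> t) w)"
    unfolding v using bilinear_lmul[OF bil] bilinear_rmul[OF bil] by (simp add: power2_eq_square)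
  then have "vector_derivative (\<lambda>s. vector_derivative (snd c \<circ> \<gamma>) (at s)) (at t) + D (\<gamma> t) v (extend M (\<gamma> t) v)
      = (?h' t)\<^sup>2 *\<^sub>R (vector_derivative ?b' (at (h t)) + D (\<gamma> t) w (extend M (\<gamma> t) w)) + vector_derivative ?h' (at t) *\<^sub>R w"
    unfolding a'' w by (simp add: scaleR_add_right)
  also have "\<dots> = (vector_derivative ?h' (at t) / ?h' t) *\<^sub>R v"
    unfolding cov v using h'0 by simp
  finally show ?thesis by (simp add: span_base span_scale)
qed

text \<open>Apply the preceding lemma for both connections to the contact geodesic tangent to \<open>u\<close>; the second
  derivative of the curve cancels in the difference.\<close>

lemma common_geodesics_difference:
  assumes D: "affine_connection M D" "affine_connection M D'"
    and C: "contact_projective_structure M H C"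
    and geo: "\<And>c. c \<in> C \<Longrightarrow> unparameterized_geodesic M D c" "\<And>c. c \<in> C \<Longrightarrow> unparameterized_geodesic M D' c"
    and H: "subspace (H p)" and u: "u \<in> H p"
  shows "D' p u (extend M p u) - D p u (extend M p u) \<in> span {u}"
proof (cases "u = 0")
  case True
  then show ?thesis
    using bilinear_lzero[OF bilinear_connection_extend[OF D(1)]] bilinear_lzero[OF bilinear_connection_extend[OF D(2)]]
    by (simp add: span_zero)
next
  case False
  have "subspace (span {u})" "dim (span {u}) = 1" "span {u} \<subseteq> H p"
    using False H u by (auto simp: span_minimal)
  then obtain c where c: "c \<in> C" "tangent_to M c p (span {u})"
    using C unfolding contact_projective_structure_def by blast
  obtain I \<gamma> where I: "c = (I, \<gamma>)" by fastforce
  obtain t where t: "t \<in> I" "\<gamma> t = p" and sp: "span {velocity M \<gamma> t} = span {u}"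
    using c(2) unfolding I tangent_to_def by auto
  define v where "v = velocity M \<gamma> t"
  have "D' p v (extend M p v) - D p v (extend M p v) \<in> span {v}"
    using span_diff[OF unparameterized_geodesic_acceleration[OF D(2) geo(2)[OF c(1), unfolded I] t(1)]
        unparameterized_geodesic_acceleration[OF D(1) geo(1)[OF c(1), unfolded I] t(1)]]
    unfolding t(2) v_def by simp
  moreover obtain k where k: "u = k *\<^sub>R v"
    using sp span_base[of u "{u}"] unfolding v_def[symmetric] by (auto simp: span_singleton)
  ultimately have "k\<^sup>2 *\<^sub>R (D' p v (extend M p v) - D p v (extend M p v)) \<in> span {u}"
    using sp unfolding v_def[symmetric] by (simp add: span_scale)
  moreover have "A p u (extend M p u) = k\<^sup>2 *\<^sub>R A p v (extend M p v)" if "affine_connection M A" for A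
    unfolding k using bilinear_lmul[OF bilinear_connection_extend[OF that]]
      bilinear_rmul[OF bilinear_connection_extend[OF that]] by (simp add: power2_eq_square)
  ultimately show ?thesis using D by (simp add: scaleR_diff_right)
qed


section \<open>The contact torsion\<close>

lemma scales_related:
  assumes Sc: "co_orientation M H Sc" "\<theta> \<in> Sc" "\<theta>' \<in> Sc"
  obtains \<sigma> where "smooth_fn M UNIV \<sigma>" "\<And>q. \<sigma> q > 0" "\<And>p v. \<theta>' p v = \<sigma> p * \<theta> p v"
proof -
  obtain \<theta>0 f g where f: "smooth_fn M UNIV f" "\<And>p. f p \<noteq> 0" "\<And>p v. \<theta> p v = (f p)\<^sup>2 * \<theta>0 p v"
    and g: "smooth_fn M UNIV g" "\<And>p. g p \<noteq> 0" "\<And>p v. \<theta>' p v = (g p)\<^sup>2 * \<theta>0 p v"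
    using Sc unfolding co_orientation_def positive_rescaling_def by blast
  show thesis
  proof (rule that)
    show "smooth_fn M UNIV (\<lambda>q. (g q * g q) * inverse (f q * f q))"
      using f g by (intro smooth_fn_mult smooth_fn_inverse) auto
    show "(g q * g q) * inverse (f q * f q) > 0" for q
      using f(2)[of q] g(2)[of q] by (simp flip: power2_eq_square)
    show "\<theta>' p v = (g p * g p) * inverse (f p * f p) * \<theta> p v" for p v
      using f(2)[of p] by (simp add: f(3) g(3) power2_eq_square field_simps)
  qed
qed

lemma scale_annihilating_form:
  assumes "co_orientation M H Sc" "\<theta> \<in> Sc"
  shows "annihilating_form M H UNIV \<theta>"
proof -
  obtain \<theta>0 f where \<theta>0: "annihilating_form M H UNIV \<theta>0"
    and f: "smooth_fn M UNIV f" "\<And>p. f p \<noteq> 0" "\<And>p v. \<theta> p v = (f p)\<^sup>2 * \<theta>0 p v"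
    using assms unfolding co_orientation_def positive_rescaling_def contact_form_def by blast
  have "one_form_on M UNIV \<theta>"
    unfolding one_form_on_def
  proof (intro conjI ballI allI impI)
    show "linear (\<theta> p)" for p
      using \<theta>0 unfolding annihilating_form_def one_form_on_def
      by (intro linearI) (auto simp: f(3) linear_add linear_scale algebra_simps)
    show "smooth_fn M V (\<lambda>p. \<theta> p (X p))" if V: "open V \<and> V \<subseteq> UNIV \<and> smooth_vf M V X" for V X
      unfolding f(3) power2_eq_square
      using V \<theta>0 smooth_fn_subset[OF f(1)] unfolding annihilating_form_def
      by (intro smooth_fn_mult smooth_fn_one_form[of \<theta>0]) auto
  qed
  then show ?thesis
    using \<theta>0 f(2) unfolding annihilating_form_def by (auto simp: f(3))
qed

lemma contact_torsion_section:
  assumes H: "contact_structure M H" and \<theta>: "annihilating_form M H UNIV \<theta>"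
    and T: "reeb_field M \<theta> T" and D: "affine_connection M D"
  shows "section_Lambda2_dual_tensor M H (contact_torsion M \<theta> T D)"
proof -
  have \<theta>1: "one_form_on M UNIV \<theta>" using \<theta> unfolding annihilating_form_def by blast
  have lin\<theta>: "linear (\<theta> p)" for p using \<theta>1 unfolding one_form_on_def by blast
  note lin = linear_add[OF lin\<theta>] linear_diff[OF lin\<theta>] linear_scale[OF lin\<theta>] linear_neg[OF lin\<theta>]
  have Hker: "H p = {v. \<theta> p v = 0}" for p by (rule contact_distribution_eq_kernel[OF H \<theta>])
  have \<theta>T: "\<theta> p (T p) = 1" for p using T unfolding reeb_field_def by blast
  have smooth: "smooth_vf M W (\<lambda>q. contact_torsion M \<theta> T D q (X q) (Y q))"
    if W: "open W" "smooth_vf M W X" "smooth_vf M W Y" for W X Y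
  proof -
    have "smooth_vf M W T" using T smooth_vf_subset unfolding reeb_field_def by blast
    then show ?thesis
      unfolding contact_torsion_def using W
      by (intro smooth_vf_diff smooth_vf_scaleR smooth_fn_one_form[OF \<theta>1] smooth_vf_torsion[OF D])
  qed
  have skew: "contact_torsion M \<theta> T D p u v = - contact_torsion M \<theta> T D p v u" for p u v
    using torsion_skew[of D p u v] by (simp add: contact_torsion_def lin)
  have lin_left: "contact_torsion M \<theta> T D p (a *\<^sub>R u + b *\<^sub>R v) w =
      a *\<^sub>R contact_torsion M \<theta> T D p u w + b *\<^sub>R contact_torsion M \<theta> T D p v w" for p u v w a b
    using bilinear_ladd[OF bilinear_torsion[OF D]] bilinear_lmul[OF bilinear_torsion[OF D]]
    by (simp add: contact_torsion_def lin algebra_simps)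
  have horizontal: "\<theta> p (contact_torsion M \<theta> T D p u v) = 0" for p u v
    by (simp add: contact_torsion_def lin \<theta>T)
  show ?thesis
    unfolding section_Lambda2_dual_tensor_def
  proof (intro conjI allI ballI impI)
    show "contact_torsion M \<theta> T D p u v \<in> H p" for p u v by (simp add: Hker horizontal)
  qed (rule skew lin_left smooth; simp)+
qed

text \<open>Here \<open>\<Lambda>\<close> is the difference of the connections, and the second Reeb equation identifies \<open>\<sigma> \<omega>(Z,\<cdot>)\<close>
  with \<open>d\<sigma>\<close> on \<open>H\<close>.\<close>

lemma contact_torsion_scale_independent:
  assumes H: "contact_structure M H" and C: "contact_projective_structure M H C"
    and \<theta>: "annihilating_form M H UNIV \<theta>" and \<theta>1': "one_form_on M UNIV \<theta>'"
    and \<sigma>: "smooth_fn M UNIV \<sigma>" "\<And>q. \<sigma> q > 0" and \<theta>': "\<And>p v. \<theta>' p v = \<sigma> p * \<theta> p v"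
    and T: "reeb_field M \<theta> T" "reeb_field M \<theta>' T'"
    and D: "associated_connection M C \<theta> T D" and D': "associated_connection M C \<theta>' T' D'"
    and uv: "u \<in> H p" "v \<in> H p"
  shows "contact_torsion M \<theta>' T' D' p u v = contact_torsion M \<theta> T D p u v"
proof -
  have \<theta>1: "one_form_on M UNIV \<theta>" using \<theta> unfolding annihilating_form_def by blast
  have lin\<theta>: "linear (\<theta> p)" using \<theta>1 unfolding one_form_on_def by blast
  note lin = linear_add[OF lin\<theta>] linear_diff[OF lin\<theta>] linear_scale[OF lin\<theta>] linear_neg[OF lin\<theta>]
  have Hker: "H p = {v. \<theta> p v = 0}" by (rule contact_distribution_eq_kernel[OF H \<theta>])
  have aff: "affine_connection M D" "parallel_one_form M D \<theta>" "parallel_two_form M D (ext_deriv M \<theta>)"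
    and aff': "affine_connection M D'" "parallel_one_form M D' \<theta>'" "parallel_two_form M D' (ext_deriv M \<theta>')"
    and tor: "\<And>v. torsion M D p (T p) v = 0" "\<And>v. torsion M D' p (T' p) v = 0"
    and tr: "\<And>v. lin_trace (torsion M D p v) = 0" "\<And>v. lin_trace (torsion M D' p v) = 0"
    and geo: "\<And>c. c \<in> C \<Longrightarrow> unparameterized_geodesic M D c" "\<And>c. c \<in> C \<Longrightarrow> unparameterized_geodesic M D' c"
    using D D' unfolding associated_connection_def by auto
  let ?\<omega> = "ext_deriv M \<theta> p"
  let ?\<tau> = "torsion M D p" and ?\<tau>' = "torsion M D' p"
  define \<Lambda> where "\<Lambda> u v = D' p u (extend M p v) - D p u (extend M p v)" for u v
  define Z where "Z = \<sigma> p *\<^sub>R T' p - T p"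
  have \<theta>T: "\<theta> p (T p) = 1" and \<theta>T': "\<sigma> p * \<theta> p (T' p) = 1"
    and \<omega>T: "\<And>v. ?\<omega> (T p) v = 0" and \<omega>T': "\<And>v. ext_deriv M \<theta>' p (T' p) v = 0"
    using T \<theta>' unfolding reeb_field_def by auto
  have bil\<omega>: "bilinear ?\<omega>" by (rule bilinear_ext_deriv[OF aff(1) \<theta>1 aff(2)])
  have bil\<tau>: "bilinear ?\<tau>" and bil\<tau>': "bilinear ?\<tau>'" using bilinear_torsion aff(1) aff'(1) by blast+
  have \<theta>\<tau>: "\<theta> p (?\<tau> u v) = ?\<omega> u v" for u v by (rule form_torsion_eq_ext_deriv[OF aff(1) \<theta>1 aff(2)])
  have \<theta>\<tau>': "\<theta> p (?\<tau>' u v) = ?\<omega> u v" if "\<theta> p u = 0" "\<theta> p v = 0" for u v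
    using form_torsion_eq_ext_deriv[OF aff'(1) \<theta>1' aff'(2), of p u v] \<sigma>(2)[of p] that
    by (simp add: \<theta>' ext_deriv_rescale[OF \<theta>1 \<sigma>(1) \<theta>'])
  have \<sigma>0: "\<And>q. \<sigma> q \<noteq> 0" using \<sigma>(2) by (metis less_irrefl)
  note parallel = rescaled_parallel_two_form[OF aff aff' \<theta>1 \<sigma>(1) \<sigma>0 \<theta>', of p]
  have \<omega>Z: "\<sigma> p * ?\<omega> Z v = dir_deriv M p v \<sigma>" if "\<theta> p v = 0" for v
  proof -
    have "\<sigma> p * ?\<omega> (T' p) v = dir_deriv M p v \<sigma> * \<theta> p (T' p)"
      using \<omega>T'[of v] that by (simp add: ext_deriv_rescale[OF \<theta>1 \<sigma>(1) \<theta>'])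
    then show ?thesis
      using \<theta>T' by (simp add: Z_def bilinear_lsub[OF bil\<omega>] bilinear_lmul[OF bil\<omega>] \<omega>T algebra_simps)
  qed
  have "?\<tau>' u v - ?\<tau> u v = ?\<omega> u v *\<^sub>R Z"
  proof (rule torsion_change_pointwise[OF lin\<theta> \<theta>T bil\<omega> _ \<omega>T _ bil\<tau> _ tr(1) bil\<tau>' _ tr(2), where \<Lambda> = \<Lambda>])
    show "?\<omega> u v = - ?\<omega> v u" for u v
      using torsion_skew[of D p u v] by (metis \<theta>\<tau> lin(4))
    show "u = 0" if "\<theta> p u = 0" "\<And>v. \<theta> p v = 0 \<Longrightarrow> ?\<omega> u v = 0" for u
      using H \<theta> that Hker unfolding contact_structure_def
      by (metis (mono_tags, lifting) UNIV_I mem_Collect_eq open_UNIV)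
    show "?\<tau> v (T p) = 0" for v using tor(1) torsion_skew[of D p v "T p"] by simp
    show "?\<tau>' v (T p + Z) = 0" for v
      using tor(2) torsion_skew[of D' p v "T' p"] by (simp add: Z_def bilinear_rmul[OF bil\<tau>'])
    show "\<theta> p Z = 0" using \<theta>T \<theta>T' by (simp add: Z_def lin)
    show "\<Lambda> u v - \<Lambda> v u = ?\<tau>' u v - ?\<tau> u v" for u v by (simp add: \<Lambda>_def torsion_eq)
    show "bilinear \<Lambda>"
      using bilinear_connection_extend[OF aff(1), of p] bilinear_connection_extend[OF aff'(1), of p]
      unfolding bilinear_def \<Lambda>_def[abs_def] by (auto intro: linear_compose_sub)
    show "\<theta> p (\<Lambda> u v) = 0" if "\<theta> p v = 0" for u v
      using parallel(1)[OF that] by (simp add: \<Lambda>_def)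
    show "\<Lambda> u u \<in> span {u}" if "\<theta> p u = 0" for u
      unfolding \<Lambda>_def
    proof (rule common_geodesics_difference[where H = H, OF aff(1) aff'(1) C geo])
      show "subspace (H p)" using H unfolding contact_structure_def by blast
    qed (use that Hker in auto)
    show "?\<omega> Z v * ?\<omega> u w = ?\<omega> (\<Lambda> v u) w + ?\<omega> u (\<Lambda> v w)"
      if "\<theta> p u = 0" "\<theta> p v = 0" "\<theta> p w = 0" for u v w
    proof -
      have "\<sigma> p * (?\<omega> Z v * ?\<omega> u w) = dir_deriv M p v \<sigma> * ?\<omega> u w"
        using \<omega>Z[OF that(2)] by simp
      also have "\<dots> = \<sigma> p * (?\<omega> (\<Lambda> v u) w + ?\<omega> u (\<Lambda> v w))"
        unfolding \<Lambda>_def by (rule parallel(2)[OF that(1,3)])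
      finally have "\<sigma> p * (?\<omega> Z v * ?\<omega> u w) = \<sigma> p * (?\<omega> (\<Lambda> v u) w + ?\<omega> u (\<Lambda> v w))" .
      then show ?thesis using \<sigma>0 by simp
    qed
  qed (use uv Hker \<theta>\<tau>' in auto)
  moreover have "\<theta>' p (?\<tau>' u v) = \<sigma> p * ?\<omega> u v" using uv Hker by (simp add: \<theta>' \<theta>\<tau>')
  ultimately show ?thesis
    by (simp add: contact_torsion_def \<theta>\<tau> Z_def algebra_simps)
qed

end

theorem theorem2p1:
  fixes M :: "('m::{t2_space, second_countable_topology}, 'e::euclidean_space) manifold"
    and n :: nat
    and H :: "'m \<Rightarrow> 'e set"
    and Sc :: "('m \<Rightarrow> 'e \<Rightarrow> real) set"
    and C :: "'m curve set"
    and \<theta> :: "'m \<Rightarrow> 'e \<Rightarrow> real"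
    and T :: "'m \<Rightarrow> 'e"
    and D :: "('m, 'e) connection"
  assumes "n \<ge> 2" and "DIM('e) = 2 * n - 1"
    and "smooth_manifold M"
    and "contact_structure M H"
    and "co_orientation M H Sc"
    and "contact_projective_structure M H C"
    and "\<theta> \<in> Sc" and "reeb_field M \<theta> T"
    and "associated_connection M C \<theta> T D"
  shows "section_Lambda2_dual_tensor M H (contact_torsion M \<theta> T D) \<and>
    (\<forall>\<theta>'\<in>Sc. \<forall>T' D'. reeb_field M \<theta>' T' \<and> associated_connection M C \<theta>' T' D' \<longrightarrow>
       (\<forall>p. \<forall>u\<in>H p. \<forall>v\<in>H p.
          contact_torsion M \<theta>' T' D' p u v = contact_torsion M \<theta> T D p u v))"
proof -
  interpret smooth_mfd M by unfold_locales fact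
  have \<theta>: "annihilating_form M H UNIV \<theta>"
    by (rule scale_annihilating_form) fact+
  show ?thesis
  proof (intro conjI ballI allI impI)
    show "section_Lambda2_dual_tensor M H (contact_torsion M \<theta> T D)"
      using assms(9) unfolding associated_connection_def
      by (intro contact_torsion_section[OF assms(4) \<theta> assms(8)]) blast
  next
    fix \<theta>' T' D' p u v
    assume \<theta>': "\<theta>' \<in> Sc" and T'D': "reeb_field M \<theta>' T' \<and> associated_connection M C \<theta>' T' D'"
      and uv: "u \<in> H p" "v \<in> H p"
    obtain \<sigma> where \<sigma>: "smooth_fn M UNIV \<sigma>" "\<And>q. \<sigma> q > 0" "\<And>p v. \<theta>' p v = \<sigma> p * \<theta> p v"
      using scales_related[OF assms(5,7) \<theta>'] by blast
    have "one_form_on M UNIV \<theta>'"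
      using scale_annihilating_form[OF assms(5) \<theta>'] unfolding annihilating_form_def by blast
    from contact_torsion_scale_independent[OF assms(4,6) \<theta> this \<sigma> assms(8) _ assms(9) _ uv] T'D'
    show "contact_torsion M \<theta>' T' D' p u v = contact_torsion M \<theta> T D p u v" by blast
  qed
qed

end
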